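(* Let $\delta>\frac{\pi^2}{4}-1$, $\alpha_0\in\mathbb{R}\setminus\{0\}$ and $\sigma_0^2\in[0,\infty)$. For $\sigma_w^2>0$ let $(\alpha_t,\sigma_t^2)$ be the real SE sequences with noise level $\sigma_w^2$ and set $\mathrm{AMSE}(\sigma_w^2,\delta):=\lim_{t\to\infty}\big[(1-|\alpha_t|)^2+\sigma_t^2\big]$. Then this limit exists for all sufficiently small $\sigma_w^2>0$, and $$\lim_{\sigma_w^2\to0}\frac{\mathrm{AMSE}(\sigma_w^2,\delta)}{\sigma_w^2}=\frac{1}{\big(1+\frac4{\pi^2}\big)^{-1}-\frac1\delta}.$$
   Context: Real state evolution. Fix $\delta>0$, $\sigma_w^2\ge0$. For $\alpha\in\mathbb{R}$, $\sigma^2\ge0$, $(\alpha,\sigma^2)\ne(0,0)$, with $\sigma=\sqrt{\sigma^2}$ and the convention $\arctan(\alpha/0)=\frac\pi2\,\mathrm{sign}(\alpha)$, define $$\psi_1(\alpha,\sigma^2)=\frac2\pi\arctan\Big(\frac\alpha\sigma\Big),\qquad \psi_2(\alpha,\sigma^2;\delta,\sigma_w^2)=\frac1\delta\Big[\alpha^2+\sigma^2+1-\frac{4\sigma}{\pi}-\frac{4\alpha}{\pi}\arctan\Big(\frac\alpha\sigma\Big)\Big]+\sigma_w^2 .$$ The real SE sequences are $\alpha_{t+1}=\psi_1(\alpha_t,\sigma_t^2)$, $\sigma_{t+1}^2=\psi_2(\alpha_t,\sigma_t^2;\delta,\sigma_w^2)$, $t\ge0$. *)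

theory Defs
  imports Complex_Main
begin

definition atan_ratio :: "real \<Rightarrow> real \<Rightarrow> real" where
  "atan_ratio a s = (if s = 0 then pi / 2 * sgn a else arctan (a / s))"

definition psi1 :: "real \<Rightarrow> real \<Rightarrow> real" where
  "psi1 a s2 = 2 / pi * atan_ratio a (sqrt s2)"

definition psi2 :: "real \<Rightarrow> real \<Rightarrow> real \<Rightarrow> real \<Rightarrow> real" where
  "psi2 a s2 \<delta> sw2 =
     1 / \<delta> * (a^2 + s2 + 1 - 4 * sqrt s2 / pi - 4 * a / pi * atan_ratio a (sqrt s2)) + sw2"

primrec SE :: "real \<Rightarrow> real \<Rightarrow> real \<Rightarrow> real \<Rightarrow> nat \<Rightarrow> real \<times> real" where
  "SE \<delta> sw2 a0 s0 0 = (a0, s0)"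
| "SE \<delta> sw2 a0 s0 (Suc t) =
     (let (a, s2) = SE \<delta> sw2 a0 s0 t in (psi1 a s2, psi2 a s2 \<delta> sw2))"

definition mse_seq :: "real \<Rightarrow> real \<Rightarrow> real \<Rightarrow> real \<Rightarrow> nat \<Rightarrow> real" where
  "mse_seq \<delta> sw2 a0 s0 t =
     (let (a, s2) = SE \<delta> sw2 a0 s0 t in (1 - \<bar>a\<bar>)^2 + s2)"

definition AMSE :: "real \<Rightarrow> real \<Rightarrow> real \<Rightarrow> real \<Rightarrow> real" where
  "AMSE \<delta> sw2 a0 s0 = lim (mse_seq \<delta> sw2 a0 s0)"

end

theory Submission
  imports Defs "HOL-Analysis.Analysis"
begin

text \<open>By symmetry let \<open>\<alpha> > 0\<close> and write \<open>s = \<sigma>\<close>, so that \<open>\<alpha>' = 1 - 2/\<pi> arctan (s/\<alpha>)\<close>.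
  The first coordinate is stationary on the curve \<open>s = h(\<alpha>) = \<alpha> cot (\<pi>\<alpha>/2)\<close>.
  Without noise, \<open>max (s, h(\<alpha>))\<close> decreases in any two consecutive steps: \<open>h(\<alpha>') = s \<alpha>'/\<alpha>\<close> handles the
  first coordinate, and for the second one everything reduces to the inequality
  \<open>p - 2k - (p - 2)k\<^sup>2 \<le> y\<^sup>2\<close> for \<open>k = y cot y\<close>, \<open>p = \<pi>\<^sup>2/4\<close>, which is where the threshold \<open>p - 1\<close> for
  \<open>\<delta>\<close> comes from. By compactness the noise-free orbit comes arbitrarily close to
  \<open>(1, 0)\<close>, and by continuity so do the orbits with small noise, after the same number of steps.
  Near \<open>(1, 0)\<close> the noisy map is a contraction, so these orbits converge to a fixed point;
  expanding the fixed point equations there gives \<open>1 - \<alpha> \<approx> 2s/\<pi>\<close> and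
  \<open>(\<delta> - 1 - 4/\<pi>\<^sup>2) s\<^sup>2 \<approx> \<delta> \<sigma>\<^sub>w\<^sup>2\<close>.\<close>

section \<open>A sharp lower bound for the cotangent\<close>

lemma pi_sq_bounds: "(986/100::real) < pi\<^sup>2" "pi\<^sup>2 < (987/100::real)"
proof -
  have "(3.1415::real)\<^sup>2 < pi\<^sup>2"
    by (rule power_strict_mono) (use pi_approx in auto)
  then show "(986/100::real) < pi\<^sup>2" by (simp add: power2_eq_square)
  have "pi\<^sup>2 < (3.1416::real)\<^sup>2"
    by (rule power_strict_mono) (use pi_approx in auto)
  then show "pi\<^sup>2 < (987/100::real)" by (simp add: power2_eq_square)
qed

lemma arctan_less_self: "0 < x \<Longrightarrow> arctan x < x" for x :: real
proof -
  assume x: "0 < x"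
  have "\<exists>z. 0 < z \<and> z < x \<and> arctan x - arctan 0 = (x - 0) * inverse (1 + z\<^sup>2)"
    by (rule MVT2[OF x]) (auto intro!: DERIV_arctan)
  then obtain z where z: "0 < z" "arctan x = x * inverse (1 + z\<^sup>2)" by auto
  have "inverse (1 + z\<^sup>2) < 1"
    using z(1) by (simp add: inverse_less_1_iff add_pos_nonneg)
  then show ?thesis
    using z x by simp
qed

lemma mult_cos_less_sin: "0 < y \<Longrightarrow> y < pi / 2 \<Longrightarrow> y * cos y < sin y" for y :: real
proof -
  assume y: "0 < y" "y < pi / 2"
  have "arctan (tan y) < tan y"
    using y by (intro arctan_less_self tan_gt_zero)
  then have "y < sin y / cos y"
    using y by (simp add: arctan_tan) (simp add: tan_def)
  then show ?thesis
    using cos_gt_zero[of y] y by (simp add: pos_less_divide_eq)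
qed

definition ycot :: "real \<Rightarrow> real" where
  "ycot y = y * cos y / sin y"

lemma ycot_half_pi [simp]: "ycot (pi / 2) = 0"
  by (simp add: ycot_def)

lemma ycot_less_1: "0 < y \<Longrightarrow> y \<le> pi / 2 \<Longrightarrow> ycot y < 1"
proof -
  assume y: "0 < y" "y \<le> pi / 2"
  have "y * cos y < sin y"
    using mult_cos_less_sin[of y] y
    by (cases "y = pi / 2") (simp_all only: cos_pi_half sin_pi_half mult_zero_right zero_less_one)
  moreover have "0 < sin y" using y by (intro sin_gt_zero) auto
  ultimately show ?thesis by (simp add: ycot_def)
qed

lemma ycot_nonneg: "0 < y \<Longrightarrow> y \<le> pi / 2 \<Longrightarrow> 0 \<le> ycot y"
  unfolding ycot_def by (intro divide_nonneg_nonneg mult_nonneg_nonneg cos_ge_zero sin_ge_zero) auto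

lemma ycot_ge_cos: "0 < y \<Longrightarrow> y \<le> pi / 2 \<Longrightarrow> cos y \<le> ycot y"
proof -
  assume y: "0 < y" "y \<le> pi / 2"
  have "0 < sin y" using y by (intro sin_gt_zero) auto
  moreover have "sin y \<le> y" using y by (intro sin_x_le_x) auto
  moreover have "0 \<le> cos y" using y by (intro cos_ge_zero) auto
  ultimately show ?thesis
    by (simp add: ycot_def pos_le_divide_eq mult.commute[of _ "cos y"] mult_left_mono)
qed

text \<open>Writing k for \<open>ycot y\<close>, this is the Riccati equation y k' = k - k^2 - y^2.
  Later derivative computations thus become polynomial identities in k and y.\<close>

lemma DERIV_ycot:
  assumes "0 < y" "y \<le> pi / 2"
  shows "(ycot has_real_derivative (ycot y - (ycot y)\<^sup>2 - y\<^sup>2) / y) (at y)"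
proof -
  have s: "0 < sin y" using assms by (intro sin_gt_zero) auto
  have "((\<lambda>y. y * cos y / sin y) has_real_derivative
      ((cos y - y * sin y) * sin y - y * cos y * cos y) / (sin y * sin y)) (at y)"
    using s by (auto intro!: derivative_eq_intros simp: algebra_simps)
  moreover have "((cos y - y * sin y) * sin y - y * cos y * cos y) / (sin y * sin y)
      = (ycot y - (ycot y)\<^sup>2 - y\<^sup>2) / y"
    using s assms by (simp add: ycot_def field_simps power2_eq_square)
  ultimately show ?thesis by (simp add: ycot_def[abs_def])
qed

text \<open>By the Riccati equation the sign of the derivative is that of k - k^2 - y^2. Multiplied
  by (sin y)^2 / y this is sin y cos y - y, which is negative because sin y \<le> y and cos y <
  1.\<close>

lemma ycot_strict_antimono:
  assumes "0 < y" "y < z" "z \<le> pi / 2"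
  shows "ycot z < ycot y"
proof (rule DERIV_neg_imp_decreasing[OF assms(2)])
  fix x assume x: "y \<le> x" "x \<le> z"
  have s: "0 < sin x" using assms x by (intro sin_gt_zero) auto
  have "sin x \<le> x" using assms x by (intro sin_x_le_x) auto
  have "cos x < cos 0" using assms x by (intro cos_monotone_0_pi) auto
  have "ycot x < (ycot x)\<^sup>2 + x\<^sup>2"
  proof -
    have "cos x * sin x < 1 * sin x"
      using \<open>cos x < cos 0\<close> s by (intro mult_strict_right_mono) auto
    then have "cos x * sin x < x" using \<open>sin x \<le> x\<close> by simp
    then have "x * (cos x * sin x) < x * x * (cos x * cos x + sin x * sin x)"
      using assms x mult_strict_left_mono[of "cos x * sin x" x x]
      by (simp flip: power2_eq_square)
    then show ?thesis
      using s unfolding distrib_left by (simp add: ycot_def field_simps power2_eq_square)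
  qed
  then have "(ycot x - (ycot x)\<^sup>2 - x\<^sup>2) / x < 0"
    using assms x by (simp add: divide_neg_pos)
  then show "\<exists>D. (ycot has_real_derivative D) (at x) \<and> D < 0"
    using DERIV_ycot[of x] assms x by auto
qed

text \<open>With \<open>c = \<pi>\<^sup>2/4 - 2\<close> and \<open>G = 2k + ck\<^sup>2 - (c + 2) + y\<^sup>2\<close>, the relation \<open>yk' = k - k\<^sup>2 - y\<^sup>2\<close> makes
  the derivative of \<open>(sin y)\<^bsup>2c\<^esup> G\<close> a positive multiple of an increasing affine function of the
  decreasing \<open>k\<close>. So this product first rises and then falls, and it vanishes at both ends.\<close>

lemma sharp_cot_bound:
  assumes y: "0 < y" "y \<le> pi / 2"
  shows "pi\<^sup>2 / 4 - 2 * ycot y - (pi\<^sup>2 / 4 - 2) * (ycot y)\<^sup>2 \<le> y\<^sup>2"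
proof -
  define c where "c = pi\<^sup>2 / 4 - 2"
  have c: "0 < c" "c < 1" using pi_sq_bounds by (auto simp: c_def)
  define G where "G z = 2 * ycot z + c * (ycot z)\<^sup>2 - (c + 2) + z\<^sup>2" for z
  define N where "N z = sin z powr (2 * c) * G z" for z
  define N' where "N' z = sin z powr (2 * c) / z *
      (2 * ycot z * (1 - ycot z) * (c * (1 - c) * ycot z - (c * (c + 2) - 1)))" for z
  have sinpos: "0 < sin z" if "0 < z" "z \<le> pi / 2" for z
    using that by (intro sin_gt_zero) auto
  have DG: "(G has_real_derivative (2 + 2 * c * ycot z) * ((ycot z - (ycot z)\<^sup>2 - z\<^sup>2) / z) + 2 * z) (at z)"
    if "0 < z" "z \<le> pi / 2" for z
    unfolding G_def
    using that
    by (auto intro!: derivative_eq_intros DERIV_ycot simp: field_simps)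
  have DN: "(N has_real_derivative N' z) (at z)" if z: "0 < z" "z \<le> pi / 2" for z
  proof -
    have "((\<lambda>z. sin z powr (2 * c)) has_real_derivative
        2 * c * sin z powr (2 * c - 1) * cos z) (at z)"
      using sinpos[OF z] by (auto intro!: derivative_eq_intros)
    moreover have "2 * c * sin z powr (2 * c - 1) * cos z = sin z powr (2 * c) / z * (2 * c * ycot z)"
      using sinpos[OF z] z by (simp add: powr_diff ycot_def field_simps)
    ultimately have "((\<lambda>z. sin z powr (2 * c)) has_real_derivative
        sin z powr (2 * c) / z * (2 * c * ycot z)) (at z)" by simp
    from DERIV_mult[OF this DG[OF z]]
    have 1: "(N has_real_derivative sin z powr (2 * c) / z * (2 * c * ycot z) * G z
       + ((2 + 2 * c * ycot z) * ((ycot z - (ycot z)\<^sup>2 - z\<^sup>2) / z) + 2 * z) * sin z powr (2 * c)) (at z)"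
      by (simp add: N_def[abs_def])
    \<comment> \<open>The exponent \<open>2 * c\<close> is the one for which all terms with z^2
      cancel. What remains is a cubic in k with the roots 0 and 1 and one affine factor.\<close>
    have 2: "2 * c * k * (2 * k + c * k\<^sup>2 - (c + 2) + z\<^sup>2)
       + ((2 + 2 * c * k) * (k - k\<^sup>2 - z\<^sup>2) + 2 * z\<^sup>2)
       = 2 * k * (1 - k) * (c * (1 - c) * k - (c * (c + 2) - 1))" for k
      by (simp add: algebra_simps power2_eq_square)
    have "sin z powr (2 * c) / z * (2 * c * ycot z) * G z
       + ((2 + 2 * c * ycot z) * ((ycot z - (ycot z)\<^sup>2 - z\<^sup>2) / z) + 2 * z) * sin z powr (2 * c)
       = sin z powr (2 * c) / z * (2 * c * ycot z * G z
          + ((2 + 2 * c * ycot z) * (ycot z - (ycot z)\<^sup>2 - z\<^sup>2) + 2 * z\<^sup>2))"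
      using z by (simp add: field_simps power2_eq_square)
    also have "\<dots> = N' z"
      unfolding G_def N'_def 2 ..
    finally show ?thesis using 1 by simp
  qed
  have sgn: "0 \<le> sin z powr (2 * c) / z * (2 * ycot z * (1 - ycot z))" if z: "0 < z" "z \<le> pi / 2" for z
    using ycot_nonneg[OF z] ycot_less_1[OF z] z by simp
  \<comment> \<open>If the affine factor is nonnegative at y, it is so on (0, y], and
    \<open>N\<close> increases from the end 0 to y. Otherwise it is negative on [y, pi/2], and
    \<open>N\<close> decreases from y to the end pi/2.\<close>
  have "0 \<le> N y"
  proof (cases "c * (1 - c) * ycot y \<ge> c * (c + 2) - 1")
    case True
    have mono: "N z \<le> N y" if z: "0 < z" "z < y" for z
    proof (rule DERIV_nonneg_imp_nondecreasing[where f = N])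
      show "z \<le> y" using z by simp
      fix x assume x: "z \<le> x" "x \<le> y"
      have x': "0 < x" "x \<le> pi / 2" using x z y by auto
      have "ycot y \<le> ycot x"
        using ycot_strict_antimono[of x y] x x' y by (cases "x = y") auto
      then have "c * (1 - c) * ycot y \<le> c * (1 - c) * ycot x"
        using c by (intro mult_left_mono) auto
      then have "0 \<le> N' x"
        using True mult_nonneg_nonneg[OF sgn[OF x'], of "c * (1 - c) * ycot x - (c * (c + 2) - 1)"]
        by (simp add: N'_def mult.assoc)
      then show "\<exists>D. (N has_real_derivative D) (at x) \<and> 0 \<le> D"
        using DN[OF x'] by blast
    qed
    have lower: "- (c + 2) * sin z powr (2 * c) \<le> N y" if z: "0 < z" "z < y" for z
    proof -
      have "- (c + 2) \<le> G z"
        using ycot_nonneg[of z] z y c by (simp add: G_def)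
      then have "sin z powr (2 * c) * (- (c + 2)) \<le> N z"
        unfolding N_def by (intro mult_left_mono) auto
      then show ?thesis using mono[OF z] by (simp add: mult.commute)
    qed
    have "((\<lambda>z. - (c + 2) * sin z powr (2 * c)) \<longlongrightarrow> - (c + 2) * sin 0 powr (2 * c)) (at_right 0)"
    proof (intro tendsto_mult tendsto_const tendsto_powr' tendsto_sin tendsto_ident_at disjI2 conjI)
      show "eventually (\<lambda>z::real. 0 \<le> sin z) (at_right 0)"
        by (rule eventually_at_rightI[of 0 pi]) (auto intro!: sin_ge_zero)
    qed (use c in auto)
    moreover have "eventually (\<lambda>z. - (c + 2) * sin z powr (2 * c) \<le> N y) (at_right 0)"
      using lower y by (intro eventually_at_rightI[of 0 y]) auto
    ultimately have "- (c + 2) * sin 0 powr (2 * c) \<le> N y"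
      by (intro tendsto_upperbound) auto
    then show ?thesis using c by simp
  next
    case False
    have "N (pi / 2) \<le> N y"
    proof (rule DERIV_nonpos_imp_nonincreasing[where f = N])
      show "y \<le> pi / 2" by fact
      fix x assume x: "y \<le> x" "x \<le> pi / 2"
      have x': "0 < x" "x \<le> pi / 2" using x y by auto
      have "ycot x \<le> ycot y"
        using ycot_strict_antimono[of y x] x x' y by (cases "x = y") auto
      then have "c * (1 - c) * ycot x \<le> c * (1 - c) * ycot y"
        using c by (intro mult_left_mono) auto
      then have "N' x \<le> 0"
        using False mult_nonneg_nonpos[OF sgn[OF x'], of "c * (1 - c) * ycot x - (c * (c + 2) - 1)"]
        by (simp add: N'_def mult.assoc)
      then show "\<exists>D. (N has_real_derivative D) (at x) \<and> D \<le> 0"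
        using DN[OF x'] by blast
    qed
    moreover have "N (pi / 2) = 0"
      by (simp add: N_def G_def c_def power2_eq_square)
    ultimately show ?thesis by simp
  qed
  then have "0 \<le> G y"
    using sinpos[OF y] by (simp add: N_def zero_le_mult_iff)
  then show ?thesis
    by (simp add: G_def c_def)
qed

section \<open>The state evolution map in the coordinates \<open>(\<alpha>, \<sigma>)\<close>\<close>

definition next_alpha :: "real \<Rightarrow> real \<Rightarrow> real" where
  "next_alpha a s = 1 - 2 / pi * arctan (s / a)"

text \<open>\<open>\<delta> (\<psi>\<^sub>2 - \<sigma>\<^sub>w\<^sup>2)\<close>, rewritten for \<open>a > 0\<close> by \<open>arctan (a/s) = \<pi>/2 - arctan (s/a)\<close>; in this
  form \<open>s = 0\<close> is a regular point.\<close>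

definition bracket :: "real \<Rightarrow> real \<Rightarrow> real" where
  "bracket a s = (1 - a)\<^sup>2 + s\<^sup>2 - 4 / pi * (s - a * arctan (s / a))"

definition nullcline :: "real \<Rightarrow> real" where
  "nullcline a = 2 / pi * ycot (pi * a / 2)"

text \<open>The minimum of \<^term>\<open>bracket\<close> over the ray of all points that \<^const>\<open>next_alpha\<close> maps to \<open>a\<close>.\<close>

definition bracket_min :: "real \<Rightarrow> real" where
  "bracket_min a = 1 - 4 / pi\<^sup>2 * (cos (pi * a / 2) + pi * a / 2 * sin (pi * a / 2))\<^sup>2"

section \<open>Monotonicity of the first coordinate on the two sides of the nullcline\<close>

lemma next_alpha_range:
  assumes "0 < a" "0 \<le> s"
  shows "0 < next_alpha a s" "next_alpha a s \<le> 1"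
  using assms arctan_ubound[of "s / a"] by (auto simp: next_alpha_def field_simps)

lemma next_alpha_angle: "pi * next_alpha a s / 2 = pi / 2 - arctan (s / a)"
  by (simp add: next_alpha_def field_simps)

text \<open>The angle of the new first coordinate is pi/2 - arctan (s/a), whose cotangent is
  s/a.\<close>

lemma ycot_next_alpha:
  "ycot (pi * next_alpha a s / 2) = pi * next_alpha a s / 2 * (s / a)"
proof -
  have "0 < 1 + (s / a)\<^sup>2" by (simp add: add_pos_nonneg)
  then show ?thesis
    unfolding ycot_def next_alpha_angle
    by (simp add: cos_diff sin_diff sin_arctan cos_arctan)
qed

lemma nullcline_next_alpha: "nullcline (next_alpha a s) = next_alpha a s * (s / a)"
  by (simp add: nullcline_def ycot_next_alpha)

lemma nullcline_nonneg: "0 < a \<Longrightarrow> a \<le> 1 \<Longrightarrow> 0 \<le> nullcline a"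
  unfolding nullcline_def by (intro mult_nonneg_nonneg ycot_nonneg) auto

lemma nullcline_less: "0 < a \<Longrightarrow> a \<le> 1 \<Longrightarrow> nullcline a < 2 / pi"
  using ycot_less_1[of "pi * a / 2"] by (simp add: nullcline_def field_simps)

lemma nullcline_1 [simp]: "nullcline 1 = 0"
  by (simp add: nullcline_def)

lemma nullcline_strict_antimono: "0 < a \<Longrightarrow> a < b \<Longrightarrow> b \<le> 1 \<Longrightarrow> nullcline b < nullcline a"
  unfolding nullcline_def by (intro mult_strict_left_mono ycot_strict_antimono) auto

lemma nullcline_pos: "0 < a \<Longrightarrow> a < 1 \<Longrightarrow> 0 < nullcline a"
  using nullcline_strict_antimono[of a 1] by simp

text \<open>With b the new first coordinate, b < a gives \<open>nullcline a < nullcline b\<close>,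
  and the latter is s b/a \<le> s. The case b > a is symmetric, and b = a means that s lies on the
  curve; trichotomy yields both equivalences.\<close>

lemma
  assumes a: "0 < a" "a \<le> 1" and s: "0 \<le> s"
  shows next_alpha_less_iff: "next_alpha a s < a \<longleftrightarrow> nullcline a < s"
    and less_next_alpha_iff: "a < next_alpha a s \<longleftrightarrow> s < nullcline a"
proof -
  define b where "b = next_alpha a s"
  have b: "0 < b" "b \<le> 1" using next_alpha_range[of a s] a s by (auto simp: b_def)
  have nb: "nullcline b = b * (s / a)" by (simp add: b_def nullcline_next_alpha)
  have "nullcline a < s" if "b < a"
    using nullcline_strict_antimono[OF b(1) that a(2)] mult_right_mono[of b a "s / a"] that a s nb
    by simp
  moreover have "s < nullcline a" if "a < b"
    using nullcline_strict_antimono[OF a(1) that b(2)] mult_right_mono[of a b "s / a"] that a s nb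
    by simp
  moreover have "s = nullcline a" if "a = b"
    using nb that a by simp
  ultimately show "next_alpha a s < a \<longleftrightarrow> nullcline a < s" "a < next_alpha a s \<longleftrightarrow> s < nullcline a"
    unfolding b_def[symmetric] by (metis less_irrefl not_less_iff_gr_or_eq)+
qed

section \<open>Bounds and monotonicity properties of \<open>bracket\<close>\<close>

lemma bracket_polar:
  assumes "0 < a"
  shows "bracket a s = 1 + a\<^sup>2 * (1 + (s / a)\<^sup>2) - 4 / pi * a * (s / a + (pi / 2 - arctan (s / a)))"
  using assms by (simp add: bracket_def field_simps power2_eq_square)

text \<open>On the ray s/a = x the bracket is a quadratic in a, and its minimum comes from
  completing the square. With R = 1 + x^2 and Z = x + \<theta> the remainder is (a R - 2 Z/pi)^2 /
  R, and Z / sqrt R equals cos \<theta> + \<theta> sin \<theta>.\<close>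

lemma bracket_min_le:
  assumes "0 < a" "0 \<le> s"
  shows "bracket_min (next_alpha a s) \<le> bracket a s"
proof -
  define x where "x = s / a"
  define \<theta> where "\<theta> = pi / 2 - arctan x"
  have x: "0 < 1 + x\<^sup>2" by (simp add: add_pos_nonneg)
  have 1: "cos \<theta> + \<theta> * sin \<theta> = (x + \<theta>) / sqrt (1 + x\<^sup>2)"
    unfolding \<theta>_def by (simp add: cos_diff sin_diff sin_arctan cos_arctan add_divide_distrib)
  have "bracket_min (next_alpha a s) = 1 - 4 / pi\<^sup>2 * ((x + \<theta>)\<^sup>2 / (1 + x\<^sup>2))"
    unfolding bracket_min_def next_alpha_angle using 1 x
    by (simp add: \<theta>_def x_def power_divide)
  moreover have "bracket a s = 1 + a\<^sup>2 * (1 + x\<^sup>2) - 4 / pi * a * (x + \<theta>)"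
    using bracket_polar[OF assms(1)] by (simp add: x_def \<theta>_def)
  moreover have "a\<^sup>2 * R - 4 / pi * a * Z + 4 / pi\<^sup>2 * (Z\<^sup>2 / R) = (a * R - 2 / pi * Z)\<^sup>2 / R"
    if "0 < R" for R Z
    using that by (simp add: field_simps power2_eq_square)
  from this[OF x, of "x + \<theta>"]
  have "a\<^sup>2 * (1 + x\<^sup>2) - 4 / pi * a * (x + \<theta>) + 4 / pi\<^sup>2 * ((x + \<theta>)\<^sup>2 / (1 + x\<^sup>2))
     = (a * (1 + x\<^sup>2) - 2 / pi * (x + \<theta>))\<^sup>2 / (1 + x\<^sup>2)" .
  moreover have "0 \<le> (a * (1 + x\<^sup>2) - 2 / pi * (x + \<theta>))\<^sup>2 / (1 + x\<^sup>2)"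
    using x by simp
  ultimately show ?thesis by linarith
qed

lemma convex_quadratic_nonpos:
  fixes w :: real
  assumes "u \<le> w" "w \<le> v" "u\<^sup>2 + b * u + c \<le> 0" "v\<^sup>2 + b * v + c \<le> 0"
  shows "w\<^sup>2 + b * w + c \<le> 0"
proof (cases "u = v")
  case False
  then have uv: "0 < v - u" using assms by simp
  \<comment> \<open>The chord over [u, v] exceeds the parabola at w by exactly (v - w) (w -
    u).\<close>
  have "(v - w) * (u\<^sup>2 + b * u + c) + (w - u) * (v\<^sup>2 + b * v + c)
      = (v - u) * (w\<^sup>2 + b * w + c) + (v - w) * (w - u) * (v - u)"
    by (simp add: algebra_simps power2_eq_square)
  moreover have "(v - w) * (u\<^sup>2 + b * u + c) \<le> 0" "(w - u) * (v\<^sup>2 + b * v + c) \<le> 0"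
    using assms by (auto intro!: mult_nonneg_nonpos)
  moreover have "0 \<le> (v - w) * (w - u) * (v - u)"
    using assms by simp
  ultimately have "(v - u) * (w\<^sup>2 + b * w + c) \<le> 0" by linarith
  then show ?thesis using uv by (simp add: mult_le_0_iff)
qed (use assms in auto)

text \<open>On a ray \<open>s/a = x\<close> the quantity \<open>(bracket a s - (\<pi>\<^sup>2/4 - 1) s\<^sup>2) / a\<^sup>2\<close> is a convex quadratic in
  \<open>1/a\<close>, so it suffices to look at \<open>a = 1\<close> and at the point of the ray on the nullcline.\<close>

lemma bracket_above_nullcline:
  assumes a: "0 < a" "a \<le> 1" and s: "0 \<le> s" "nullcline a \<le> s"
  shows "bracket a s \<le> (pi\<^sup>2 / 4 - 1) * s\<^sup>2"
proof -
  define x where "x = s / a"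
  define \<theta> where "\<theta> = pi / 2 - arctan x"
  define b where "b = next_alpha a s"
  have x: "0 \<le> x" "s = a * x" using a s by (auto simp: x_def)
  have b: "0 < b" "b \<le> a" "b \<le> 1"
    using next_alpha_range[of a s] less_next_alpha_iff[of a s] a s by (auto simp: b_def)
  have \<theta>: "\<theta> = pi * b / 2" by (simp add: \<theta>_def x_def b_def next_alpha_angle)
  have \<theta>pos: "0 < \<theta>" "\<theta> \<le> pi / 2" using b by (auto simp: \<theta>)
  have k: "ycot \<theta> = \<theta> * x"
    using ycot_next_alpha[of a s] by (simp add: \<theta> b_def x_def)
  define B where "B = - (4 / pi * (x + \<theta>))"
  define C where "C = 1 + x\<^sup>2 - (pi\<^sup>2 / 4 - 1) * x\<^sup>2"
  have "1\<^sup>2 + B * 1 + C \<le> 0"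
  proof -
    have "arctan x \<le> x" using x by (intro arctan_le_self)
    then have "0 \<le> 4 / pi * (x - arctan x)" by simp
    moreover have "0 \<le> (pi\<^sup>2 / 4 - 2) * x\<^sup>2" using pi_sq_bounds by simp
    moreover have "1\<^sup>2 + B * 1 + C = - (4 / pi * (x - arctan x)) - (pi\<^sup>2 / 4 - 2) * x\<^sup>2"
      by (simp add: B_def C_def \<theta>_def field_simps)
    ultimately show ?thesis by linarith
  qed
  \<comment> \<open>The ray meets the nullcline where the first coordinate equals b, that is at 1/a
    = pi / (2 \<theta>). There the claim is \<open>sharp_cot_bound\<close> at \<theta>.\<close>
  moreover have "(pi / (2 * \<theta>))\<^sup>2 + B * (pi / (2 * \<theta>)) + C \<le> 0"
  proof -
    have "\<theta>\<^sup>2 * ((pi / (2 * \<theta>))\<^sup>2 + B * (pi / (2 * \<theta>)) + C)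
       = pi\<^sup>2 / 4 - 2 * (\<theta> * x) - (pi\<^sup>2 / 4 - 2) * (\<theta> * x)\<^sup>2 - \<theta>\<^sup>2"
      using \<theta>pos by (simp add: B_def C_def field_simps power2_eq_square)
    also have "\<dots> \<le> 0"
      using sharp_cot_bound[OF \<theta>pos] by (simp add: k)
    finally show ?thesis using \<theta>pos by (simp add: mult_le_0_iff)
  qed
  moreover have "1 \<le> 1 / a" "1 / a \<le> pi / (2 * \<theta>)"
    using a b by (auto simp: \<theta> field_simps)
  ultimately have "(1 / a)\<^sup>2 + B * (1 / a) + C \<le> 0"
    by (intro convex_quadratic_nonpos[of 1 "1 / a" "pi / (2 * \<theta>)"])
  then have "a\<^sup>2 * ((1 / a)\<^sup>2 + B * (1 / a) + C) \<le> 0"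
    by (simp add: mult_nonneg_nonpos)
  moreover have "a\<^sup>2 * ((1 / a)\<^sup>2 + B * (1 / a) + C) = bracket a s - (pi\<^sup>2 / 4 - 1) * s\<^sup>2"
    using a unfolding bracket_polar[OF a(1)]
    by (simp add: B_def C_def \<theta>_def x(2) field_simps power2_eq_square)
  ultimately show ?thesis by linarith
qed

lemma DERIV_bracket:
  assumes "0 < a"
  shows "((\<lambda>s. bracket a s) has_real_derivative 2 * s - 4 / pi * (s\<^sup>2 / (a\<^sup>2 + s\<^sup>2))) (at s)"
proof -
  have p: "0 < a\<^sup>2 + s\<^sup>2" using assms by (simp add: add_pos_nonneg)
  have "((\<lambda>s. bracket a s) has_real_derivative
     2 * s - 4 / pi * (1 - a * (inverse (1 + (s / a)\<^sup>2) * (1 / a)))) (at s)"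
    unfolding bracket_def using assms
    by (auto intro!: derivative_eq_intros DERIV_arctan[THEN DERIV_chain2])
  moreover have "1 - a * (inverse (1 + (s / a)\<^sup>2) * (1 / a)) = s\<^sup>2 / (a\<^sup>2 + s\<^sup>2)"
    using assms p by (simp add: field_simps power2_eq_square)
  ultimately show ?thesis by (simp only:)
qed

lemma cos_plus_mult_sin_le: "0 \<le> y \<Longrightarrow> y \<le> pi / 2 \<Longrightarrow> cos y + y * sin y \<le> 1 + y\<^sup>2 / 2" for y :: real
proof -
  assume y: "0 \<le> y" "y \<le> pi / 2"
  have "1 + 0\<^sup>2 / 2 - (cos 0 + 0 * sin 0) \<le> 1 + y\<^sup>2 / 2 - (cos y + y * sin (y::real))"
  proof (rule DERIV_nonneg_imp_nondecreasing[where f = "\<lambda>y. 1 + y\<^sup>2 / 2 - (cos y + y * sin y)"])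
    fix x assume x: "0 \<le> x" "x \<le> y"
    have "((\<lambda>y. 1 + y\<^sup>2 / 2 - (cos y + y * sin y)) has_real_derivative x * (1 - cos x)) (at x)"
      by (auto intro!: derivative_eq_intros simp: algebra_simps)
    then show "\<exists>D. ((\<lambda>y. 1 + y\<^sup>2 / 2 - (cos y + y * sin y)) has_real_derivative D) (at x) \<and> 0 \<le> D"
      using x by (intro exI[of _ "x * (1 - cos x)"]) auto
  qed (use y in auto)
  then show ?thesis by simp
qed

text \<open>The function cos y + y sin y has derivative y cos y, so it stays below its value pi/2 at
  y = pi/2.\<close>

lemma bracket_min_pos:
  assumes "0 < a" "a < 1"
  shows "0 < bracket_min a"
proof -
  define g where "g y = cos y + y * sin (y::real)" for y
  define y where "y = pi * a / 2"
  have y: "0 < y" "y < pi / 2" using assms by (auto simp: y_def)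
  have "g y < g (pi / 2)"
  proof (rule DERIV_pos_imp_increasing_open[OF y(2)])
    fix x assume x: "y < x" "x < pi / 2"
    have "(g has_real_derivative x * cos x) (at x)"
      unfolding g_def by (auto intro!: derivative_eq_intros simp: algebra_simps)
    then show "\<exists>D. (g has_real_derivative D) (at x) \<and> 0 < D"
      using x y mult_pos_pos[of x "cos x"] cos_gt_zero[of x]
      by (intro exI[of _ "x * cos x"]) auto
  qed (auto simp: g_def intro!: continuous_intros)
  then have "g y < pi / 2" by (simp add: g_def)
  moreover have "0 \<le> g y"
    unfolding g_def using y by (intro add_nonneg_nonneg mult_nonneg_nonneg cos_ge_zero sin_ge_zero) auto
  ultimately have "(g y)\<^sup>2 < (pi / 2)\<^sup>2"
    by (intro power_strict_mono) auto
  then have "4 / pi\<^sup>2 * (g y)\<^sup>2 < 4 / pi\<^sup>2 * (pi / 2)\<^sup>2"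
    by (intro mult_strict_left_mono) auto
  then show ?thesis
    by (simp add: bracket_min_def g_def y_def power_divide)
qed

text \<open>Made for \<open>bracket_mono_above\<close>: divided by pi^2/4 - 1, the constraint on s
  there becomes s^2 \<ge> 4/pi^2 - 2 a^2. The coefficient 2 suffices because 1 + pi^2/16 \<le> 2
  (pi^2/4 - 1).\<close>

lemma bracket_min_ge:
  assumes "0 \<le> a" "a \<le> 1"
  shows "(pi\<^sup>2 / 4 - 1) * (4 / pi\<^sup>2 - 2 * a\<^sup>2) \<le> bracket_min a"
proof -
  define y where "y = pi * a / 2"
  have y: "0 \<le> y" "y \<le> pi / 2" using assms by (auto simp: y_def)
  have "0 \<le> cos y + y * sin y"
    using y by (intro add_nonneg_nonneg mult_nonneg_nonneg cos_ge_zero sin_ge_zero) auto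
  then have "(cos y + y * sin y)\<^sup>2 \<le> (1 + y\<^sup>2 / 2)\<^sup>2"
    using cos_plus_mult_sin_le[OF y] by (intro power_mono) auto
  then have "4 / pi\<^sup>2 * (cos y + y * sin y)\<^sup>2 \<le> 4 / pi\<^sup>2 * (1 + y\<^sup>2 / 2)\<^sup>2"
    by (intro mult_left_mono) auto
  also have "4 / pi\<^sup>2 * (1 + y\<^sup>2 / 2)\<^sup>2 = 4 / pi\<^sup>2 + a\<^sup>2 + pi\<^sup>2 / 16 * (a\<^sup>2 * a\<^sup>2)"
    by (simp add: y_def field_simps power2_eq_square)
  also have "pi\<^sup>2 / 16 * (a\<^sup>2 * a\<^sup>2) \<le> pi\<^sup>2 / 16 * (a\<^sup>2 * 1)"
    using assms by (intro mult_left_mono) (auto simp: abs_square_le_1)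
  finally have 1: "1 - 4 / pi\<^sup>2 - (1 + pi\<^sup>2 / 16) * a\<^sup>2 \<le> bracket_min a"
    by (simp add: bracket_min_def y_def algebra_simps)
  have "(1 + pi\<^sup>2 / 16) * a\<^sup>2 \<le> 2 * (pi\<^sup>2 / 4 - 1) * a\<^sup>2"
    using pi_sq_bounds by (intro mult_right_mono) auto
  moreover have "(pi\<^sup>2 / 4 - 1) * (4 / pi\<^sup>2 - 2 * a\<^sup>2) = 1 - 4 / pi\<^sup>2 - 2 * (pi\<^sup>2 / 4 - 1) * a\<^sup>2"
    by (simp add: field_simps)
  ultimately show ?thesis using 1 by linarith
qed

text \<open>The derivative at v > 0 is nonnegative iff 2 v/pi \<le> a^2 + v^2. This follows from 4
  v/pi \<le> 4/pi^2 + v^2 and the lower bound 4/pi^2 - 2 a^2 for v^2.\<close>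

lemma bracket_mono_above:
  assumes a: "0 < a" "a \<le> 1" and s: "0 < s" "s \<le> t" "bracket_min a \<le> (pi\<^sup>2 / 4 - 1) * s\<^sup>2"
  shows "bracket a s \<le> bracket a t"
proof (rule DERIV_nonneg_imp_nondecreasing[where f = "bracket a", OF s(2)])
  fix v assume v: "s \<le> v" "v \<le> t"
  have "(pi\<^sup>2 / 4 - 1) * (4 / pi\<^sup>2 - 2 * a\<^sup>2) \<le> (pi\<^sup>2 / 4 - 1) * s\<^sup>2"
    using bracket_min_ge[of a] a s by simp
  then have "4 / pi\<^sup>2 - 2 * a\<^sup>2 \<le> s\<^sup>2"
    using pi_sq_bounds by (simp add: mult_le_cancel_left_pos)
  also have "s\<^sup>2 \<le> v\<^sup>2" using s v by (intro power_mono) auto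
  finally have "4 / pi\<^sup>2 + v\<^sup>2 \<le> 2 * (a\<^sup>2 + v\<^sup>2)" by simp
  moreover define z where "z = 2 / pi * v"
  have "(2 / pi - v)\<^sup>2 = 4 / pi\<^sup>2 + v\<^sup>2 - 2 * z"
    by (simp add: z_def power2_diff power_divide)
  then have "2 * z \<le> 4 / pi\<^sup>2 + v\<^sup>2"
    using zero_le_power2[of "2 / pi - v"] by (simp only: diff_ge_0_iff_ge)
  ultimately have "2 * z \<le> 2 * (a\<^sup>2 + v\<^sup>2)" by (rule order_trans[rotated])
  then have "z \<le> a\<^sup>2 + v\<^sup>2" by simp
  then have "2 / pi * v \<le> a\<^sup>2 + v\<^sup>2" by (simp only: z_def)
  then have "2 * v * (2 / pi * v) \<le> 2 * v * (a\<^sup>2 + v\<^sup>2)"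
    using v s by (intro mult_left_mono) auto
  moreover have "0 < a\<^sup>2 + v\<^sup>2" using a by (simp add: add_pos_nonneg)
  ultimately have "2 * v * (2 / pi * v) / (a\<^sup>2 + v\<^sup>2) \<le> 2 * v"
    by (simp only: pos_divide_le_eq)
  moreover have "4 / pi * (v\<^sup>2 / (a\<^sup>2 + v\<^sup>2)) = 2 * v * (2 / pi * v) / (a\<^sup>2 + v\<^sup>2)"
    by (simp add: power2_eq_square)
  ultimately have "0 \<le> 2 * v - 4 / pi * (v\<^sup>2 / (a\<^sup>2 + v\<^sup>2))"
    by (simp only: diff_ge_0_iff_ge)
  then show "\<exists>D. (bracket a has_real_derivative D) (at v) \<and> 0 \<le> D"
    using DERIV_bracket[OF a(1), of v] by blast
qed

lemma sq_mult_bracket_strict_mono: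
  assumes a: "0 < a" "a \<le> 1" and s: "0 < s" "s < t"
  shows "s\<^sup>2 * bracket a s < t\<^sup>2 * bracket a t"
proof (rule DERIV_pos_imp_increasing[where f = "\<lambda>s. s\<^sup>2 * bracket a s", OF s(2)])
  fix v assume v: "s \<le> v" "v \<le> t"
  then have vpos: "0 < v" using s by simp
  have r: "0 < a\<^sup>2 + v\<^sup>2" using a by (simp add: add_pos_nonneg)
  let ?D = "2 * v * (bracket a v + (v\<^sup>2 - 2 / pi * (v ^ 3 / (a\<^sup>2 + v\<^sup>2))))"
  have "((\<lambda>s. s\<^sup>2 * bracket a s) has_real_derivative
     2 * v * bracket a v + (2 * v - 4 / pi * (v\<^sup>2 / (a\<^sup>2 + v\<^sup>2))) * v\<^sup>2) (at v)"
    by (rule derivative_eq_intros DERIV_bracket a refl | simp)+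
  moreover have "2 * v * bracket a v + (2 * v - 4 / pi * (v\<^sup>2 / (a\<^sup>2 + v\<^sup>2))) * v\<^sup>2 = ?D"
    by (simp add: field_simps power2_eq_square power3_eq_cube)
  ultimately have D: "((\<lambda>s. s\<^sup>2 * bracket a s) has_real_derivative ?D) (at v)" by simp
  \<comment> \<open>For a \<ge> 1/pi the inequality 2 a v \<le> a^2 + v^2 makes the difference after
    the positive bracket nonnegative. For smaller a, dropping the arctan term and using v^3 / (a^2 +
    v^2) \<le> v leaves 2 v^2 - 6 v/pi + (1 - a)^2, which is positive because (pi - 1)^2 >
    9/2.\<close>
  have "0 < bracket a v + (v\<^sup>2 - 2 / pi * (v ^ 3 / (a\<^sup>2 + v\<^sup>2)))"
  proof (cases "1 / pi \<le> a")
    case True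
    have "next_alpha a v < 1" using a vpos by (simp add: next_alpha_def)
    then have "0 < bracket a v"
      using bracket_min_pos[of "next_alpha a v"] bracket_min_le[of a v] next_alpha_range[of a v] a vpos
      by auto
    moreover have "2 / pi * (v ^ 3 / (a\<^sup>2 + v\<^sup>2)) \<le> v\<^sup>2"
    proof -
      have "2 * (1 / pi * v) \<le> 2 * (a * v)"
        using True vpos by (intro mult_left_mono mult_right_mono) auto
      also have "\<dots> \<le> a\<^sup>2 + v\<^sup>2" using sum_squares_bound[of a v] by simp
      finally have "v\<^sup>2 * (2 * (1 / pi * v)) \<le> v\<^sup>2 * (a\<^sup>2 + v\<^sup>2)" by (intro mult_left_mono) auto
      then have "v\<^sup>2 * (2 * (1 / pi * v)) / (a\<^sup>2 + v\<^sup>2) \<le> v\<^sup>2"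
        using r by (simp only: pos_divide_le_eq)
      then show ?thesis by (simp add: power2_eq_square power3_eq_cube mult_ac)
    qed
    ultimately show ?thesis by linarith
  next
    case False
    have "v ^ 3 / (a\<^sup>2 + v\<^sup>2) \<le> v"
      using r vpos a by (simp add: field_simps power2_eq_square power3_eq_cube)
    then have 1: "2 / pi * (v ^ 3 / (a\<^sup>2 + v\<^sup>2)) \<le> 2 / pi * v"
      by (intro mult_left_mono) auto
    have "0 \<le> 4 / pi * (a * arctan (v / a))" using a vpos by simp
    then have 2: "(1 - a)\<^sup>2 + v\<^sup>2 - 4 / pi * v \<le> bracket a v"
      by (simp add: bracket_def algebra_simps)
    have "(1 - 1 / pi)\<^sup>2 < (1 - a)\<^sup>2"
      using False pi_gt3 by (intro power_strict_mono) (auto simp: field_simps)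
    moreover have "(9 / 2) / pi\<^sup>2 < (1 - 1 / pi)\<^sup>2"
    proof -
      have "(2.14::real)\<^sup>2 \<le> (pi - 1)\<^sup>2"
        using pi_approx by (intro power_mono) auto
      then have "9 / 2 < (pi - 1)\<^sup>2" by (simp add: power2_eq_square)
      then have "(9 / 2) / pi\<^sup>2 < (pi - 1)\<^sup>2 / pi\<^sup>2" by (intro divide_strict_right_mono) auto
      also have "\<dots> = (1 - 1 / pi)\<^sup>2" by (simp add: power_divide[symmetric] diff_divide_distrib)
      finally show ?thesis .
    qed
    moreover have "0 \<le> 2 * (v - (3 / 2) / pi)\<^sup>2" by simp
    moreover have "2 * (v - (3 / 2) / pi)\<^sup>2 = 2 * v\<^sup>2 - 6 / pi * v + (9 / 2) / pi\<^sup>2"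
      by (simp add: field_simps power2_eq_square)
    moreover have "4 / pi * v + 2 / pi * v = 6 / pi * v" by (simp add: field_simps)
    ultimately show ?thesis using 1 2 by linarith
  qed
  then show "\<exists>D. ((\<lambda>s. s\<^sup>2 * bracket a s) has_real_derivative D) (at v) \<and> 0 < D"
    using D vpos by (intro exI[of _ ?D]) auto
qed

text \<open>\<^term>\<open>bracket\<close> is not monotone in \<open>s\<close>. Let \<open>r\<close> be the lower bound that the last assumption would
  give for \<open>s\<close> if \<open>\<delta>\<close> were the critical value. Above \<open>r\<close>, \<^term>\<open>bracket\<close> increases up to the
  nullcline; below \<open>r\<close> one uses that \<open>s\<^sup>2 bracket a s\<close> always increases.\<close>

lemma bracket_below_nullcline:
  assumes \<delta>: "pi\<^sup>2 / 4 - 1 < \<delta>" and a: "0 < a" "a < 1"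
    and s: "0 \<le> s" "s \<le> nullcline a" "bracket_min a \<le> \<delta> * s\<^sup>2"
  shows "bracket a s < \<delta> * (nullcline a)\<^sup>2"
proof -
  define d where "d = pi\<^sup>2 / 4 - 1"
  have d: "0 < d" using pi_sq_bounds by (simp add: d_def)
  define t where "t = nullcline a"
  have t: "0 < t" using nullcline_pos a by (simp add: t_def)
  have spos: "0 < s" using bracket_min_pos[OF a] s by (cases "s = 0") auto
  have Ft: "bracket a t \<le> d * t\<^sup>2"
    using bracket_above_nullcline[of a t] a t by (simp add: t_def d_def)
  have dt: "d * t\<^sup>2 < \<delta> * t\<^sup>2" using \<delta> t by (simp add: d_def)
  have fixt: "next_alpha a t = a"
    using less_next_alpha_iff[of a t] next_alpha_less_iff[of a t] a t by (auto simp: t_def)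
  then have Lt: "bracket_min a \<le> d * t\<^sup>2"
    using bracket_min_le[of a t] Ft a t by simp
  show ?thesis
  proof (cases "bracket_min a \<le> d * s\<^sup>2")
    case True
    then have "bracket a s \<le> bracket a t"
      using a s spos by (intro bracket_mono_above) (auto simp: d_def t_def)
    then show ?thesis using Ft dt by (simp add: t_def)
  next
    case False
    \<comment> \<open>The two monotonicity facts meet at \<open>r\<close>. With F =
      \<open>bracket a\<close> the chain is s^2 F(s) < r^2 F(r) \<le> r^2 d t^2 =
      \<open>bracket_min a\<close> t^2 \<le> \<delta> s^2 t^2, and then s^2 cancels.\<close>
    define r where "r = sqrt (bracket_min a / d)"
    have r2: "d * r\<^sup>2 = bracket_min a" and rpos: "0 < r"
      using d bracket_min_pos[OF a] by (auto simp: r_def)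
    have "d * s\<^sup>2 < d * r\<^sup>2" using False r2 by simp
    then have sr: "s < r" using d rpos by (auto intro: power_less_imp_less_base)
    have "d * r\<^sup>2 \<le> d * t\<^sup>2" using Lt r2 by simp
    then have rt: "r \<le> t" using d t by (intro power2_le_imp_le[of r t]) auto
    have "s\<^sup>2 * bracket a s < r\<^sup>2 * bracket a r"
      using a spos sr by (intro sq_mult_bracket_strict_mono) auto
    also have "\<dots> \<le> r\<^sup>2 * (d * t\<^sup>2)"
      using bracket_mono_above[of a r t] a rpos rt r2 Ft
      by (intro mult_left_mono) (auto simp: d_def)
    also have "\<dots> = bracket_min a * t\<^sup>2" using r2 by (simp add: mult_ac)
    also have "\<dots> \<le> \<delta> * s\<^sup>2 * t\<^sup>2" using s by (intro mult_right_mono) auto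
    finally have "s\<^sup>2 * bracket a s < s\<^sup>2 * (\<delta> * t\<^sup>2)" by (simp add: mult_ac)
    then show ?thesis using spos by (simp add: t_def)
  qed
qed

section \<open>Noise-free dynamics\<close>

definition se_step :: "real \<Rightarrow> real \<Rightarrow> real \<times> real \<Rightarrow> real \<times> real" where
  "se_step \<delta> w z = (next_alpha (fst z) (snd z), sqrt (bracket (fst z) (snd z) / \<delta> + w))"

text \<open>The last condition is what \<open>bracket_below_nullcline\<close> requires. Every image
  point of \<open>se_step\<close> satisfies it, since \<open>bracket_min\<close> at the new first
  coordinate is at most the bracket that produced the new second one.\<close>

definition admissible :: "real \<Rightarrow> (real \<times> real) set" where
  "admissible \<delta> = {z. 0 < fst z \<and> fst z \<le> 1 \<and> 0 \<le> snd z \<and> bracket_min (fst z) \<le> \<delta> * (snd z)\<^sup>2}"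

definition lyapunov :: "real \<times> real \<Rightarrow> real" where
  "lyapunov z = max (snd z) (nullcline (fst z))"

lemma bracket_nonneg:
  assumes "0 < a" "0 \<le> s"
  shows "0 \<le> bracket a s"
proof -
  have "bracket_min 1 = 0" by (simp add: bracket_min_def power_divide)
  then have "0 \<le> bracket_min (next_alpha a s)"
    using bracket_min_pos[of "next_alpha a s"] next_alpha_range[OF assms]
    by (cases "next_alpha a s = 1") auto
  then show ?thesis using bracket_min_le[OF assms] by linarith
qed

lemma se_step_admissible:
  assumes "0 < \<delta>" "0 \<le> w" "0 < fst z" "0 \<le> snd z"
  shows "se_step \<delta> w z \<in> admissible \<delta>"
proof -
  have "0 \<le> bracket (fst z) (snd z) / \<delta> + w"
    using bracket_nonneg assms by simp
  moreover have "bracket_min (next_alpha (fst z) (snd z)) \<le> \<delta> * (bracket (fst z) (snd z) / \<delta> + w)"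
    using bracket_min_le[OF assms(3,4)] assms(1,2) by (simp add: distrib_left add_increasing2)
  ultimately show ?thesis
    using next_alpha_range[OF assms(3,4)]
    by (simp add: se_step_def admissible_def)
qed

lemma snd_se_step_less_lyapunov:
  assumes \<delta>: "pi\<^sup>2 / 4 - 1 < \<delta>" and z: "z \<in> admissible \<delta>" and V: "0 < lyapunov z"
  shows "snd (se_step \<delta> 0 z) < lyapunov z"
proof -
  obtain a s where [simp]: "z = (a, s)" by force
  have as: "0 < a" "a \<le> 1" "0 \<le> s" "bracket_min a \<le> \<delta> * s\<^sup>2"
    using z by (auto simp: admissible_def)
  have \<delta>0: "0 < \<delta>" using \<delta> pi_sq_bounds by simp
  have "bracket a s < \<delta> * (lyapunov z)\<^sup>2"
  proof (cases "nullcline a \<le> s")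
    case True
    then have Vs: "lyapunov z = s" by (simp add: lyapunov_def)
    have "bracket a s \<le> (pi\<^sup>2 / 4 - 1) * s\<^sup>2"
      using bracket_above_nullcline as True by blast
    also have "\<dots> < \<delta> * s\<^sup>2" using \<delta> V Vs by simp
    finally show ?thesis using Vs by simp
  next
    case False
    then have Vs: "lyapunov z = nullcline a" by (simp add: lyapunov_def)
    have "a \<noteq> 1" using False as by auto
    then show ?thesis
      using bracket_below_nullcline[OF \<delta>, of a s] as False Vs by simp
  qed
  then have "bracket a s / \<delta> < (lyapunov z)\<^sup>2"
    using \<delta>0 by (simp add: pos_divide_less_eq mult.commute)
  then have "sqrt (bracket a s / \<delta>) < sqrt ((lyapunov z)\<^sup>2)" by (rule real_sqrt_less_mono)
  then show ?thesis using V by (simp add: se_step_def)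
qed

text \<open>The new nullcline value is s b/a. Above the nullcline b < a puts it below s; below the
  nullcline b > a, and \<open>nullcline\<close> is decreasing.\<close>

lemma nullcline_se_step_le_lyapunov:
  assumes z: "z \<in> admissible \<delta>"
  shows "nullcline (fst (se_step \<delta> w z)) \<le> lyapunov z"
    and "snd z \<noteq> nullcline (fst z) \<Longrightarrow> 0 < lyapunov z \<Longrightarrow> nullcline (fst (se_step \<delta> w z)) < lyapunov z"
proof -
  obtain a s where [simp]: "z = (a, s)" by force
  have as: "0 < a" "a \<le> 1" "0 \<le> s" using z by (auto simp: admissible_def)
  define b where "b = next_alpha a s"
  have b: "0 < b" "b \<le> 1" using next_alpha_range[of a s] as by (auto simp: b_def)
  have nb: "nullcline b = s * (b / a)" by (simp add: b_def nullcline_next_alpha)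
  consider "s = nullcline a" | "nullcline a < s" | "s < nullcline a" by linarith
  then have "nullcline b \<le> lyapunov z \<and> (s \<noteq> nullcline a \<longrightarrow> 0 < lyapunov z \<longrightarrow> nullcline b < lyapunov z)"
  proof cases
    case 1
    then have "b = a"
      using next_alpha_less_iff[of a s] less_next_alpha_iff[of a s] as by (auto simp: b_def)
    then show ?thesis using 1 by (simp add: lyapunov_def)
  next
    case 2
    then have "b / a < 1" using next_alpha_less_iff[of a s] as by (simp add: b_def)
    moreover have "0 < s" using 2 nullcline_nonneg[of a] as by simp
    ultimately have "s * (b / a) < s * 1" by (intro mult_strict_left_mono)
    then show ?thesis using 2 by (simp add: nb lyapunov_def)
  next
    case 3
    then have "a < b" using less_next_alpha_iff[of a s] as by (simp add: b_def)
    then have "nullcline b < nullcline a" using as b by (intro nullcline_strict_antimono)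
    then show ?thesis using 3 by (simp add: lyapunov_def)
  qed
  then show "nullcline (fst (se_step \<delta> w z)) \<le> lyapunov z"
    and "snd z \<noteq> nullcline (fst z) \<Longrightarrow> 0 < lyapunov z \<Longrightarrow> nullcline (fst (se_step \<delta> w z)) < lyapunov z"
    by (auto simp: se_step_def b_def)
qed

context
  fixes \<delta> :: real
  assumes \<delta>: "pi\<^sup>2 / 4 - 1 < \<delta>"
begin

lemma delta_pos: "0 < \<delta>"
  using \<delta> pi_sq_bounds by simp

lemma se_step_admissible': "z \<in> admissible \<delta> \<Longrightarrow> se_step \<delta> 0 z \<in> admissible \<delta>"
  by (rule se_step_admissible) (auto simp: delta_pos admissible_def)

lemma lyapunov_se_step_le:
  assumes z: "z \<in> admissible \<delta>"
  shows "lyapunov (se_step \<delta> 0 z) \<le> lyapunov z"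
proof (cases "0 < lyapunov z")
  case True
  then show ?thesis
    using snd_se_step_less_lyapunov[OF \<delta> z] nullcline_se_step_le_lyapunov(1)[OF z, of 0]
    by (simp add: lyapunov_def)
next
  case False
  \<comment> \<open>A vanishing \<open>lyapunov\<close> forces the point (1, 0), which is
    fixed.\<close>
  then have s: "snd z = 0" "nullcline (fst z) = 0"
    using z nullcline_nonneg[of "fst z"] by (auto simp: lyapunov_def admissible_def max_def split: if_splits)
  then have "fst z = 1"
    using z nullcline_pos[of "fst z"] by (cases "fst z = 1") (auto simp: admissible_def)
  then show ?thesis using s
    by (simp add: se_step_def next_alpha_def bracket_def lyapunov_def)
qed

lemma lyapunov_se_step_less:
  assumes z: "z \<in> admissible \<delta>" and V: "0 < lyapunov z" and ne: "snd z \<noteq> nullcline (fst z)"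
  shows "lyapunov (se_step \<delta> 0 z) < lyapunov z"
  using snd_se_step_less_lyapunov[OF \<delta> z V] nullcline_se_step_le_lyapunov(2)[OF z ne V, of 0]
  by (simp add: lyapunov_def)

text \<open>A point on the nullcline keeps its first coordinate, so there the decrease only
  shows after a second step.\<close>

lemma lyapunov_se_step_se_step_less:
  assumes z: "z \<in> admissible \<delta>" and V: "0 < lyapunov z"
  shows "lyapunov (se_step \<delta> 0 (se_step \<delta> 0 z)) < lyapunov z"
proof -
  let ?z = "se_step \<delta> 0 z"
  have z': "?z \<in> admissible \<delta>" using z by (rule se_step_admissible')
  note le = lyapunov_se_step_le[OF z] lyapunov_se_step_le[OF z']
  show ?thesis
  proof (cases "lyapunov ?z < lyapunov z")
    case True
    then show ?thesis using le by simp
  next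
    case False
    then have eq: "lyapunov ?z = lyapunov z" using le by simp
    have "snd ?z < lyapunov ?z" using snd_se_step_less_lyapunov[OF \<delta> z V] eq by simp
    then have "snd ?z \<noteq> nullcline (fst ?z)" by (auto simp: lyapunov_def)
    then have "lyapunov (se_step \<delta> 0 ?z) < lyapunov ?z"
      using lyapunov_se_step_less[OF z'] eq V by simp
    then show ?thesis by (simp add: eq)
  qed
qed

section \<open>The noise-free orbit comes arbitrarily close to (1, 0)\<close>

lemma orbit_admissible: "z \<in> admissible \<delta> \<Longrightarrow> (se_step \<delta> 0 ^^ n) z \<in> admissible \<delta>"
  by (induction n) (auto intro: se_step_admissible')

lemma lyapunov_orbit_antimono:
  assumes "z \<in> admissible \<delta>" "m \<le> n"
  shows "lyapunov ((se_step \<delta> 0 ^^ n) z) \<le> lyapunov ((se_step \<delta> 0 ^^ m) z)"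
  using assms(2)
proof (induction n rule: dec_induct)
  case (step n)
  have "lyapunov ((se_step \<delta> 0 ^^ Suc n) z) \<le> lyapunov ((se_step \<delta> 0 ^^ n) z)"
    using lyapunov_se_step_le[OF orbit_admissible[OF assms(1)]] by simp
  then show ?case using step.IH by simp
qed simp

text \<open>Since \<open>nullcline\<close> stays below 2/pi, an orbit with \<open>lyapunov\<close>
  \<ge> 2/pi lies above the nullcline, where each step shrinks s^2 by the factor \<rho> < 1. Once
  below this level, the first coordinate is bounded away from 0, as compactness demands.\<close>

lemma orbit_lyapunov_less_two_div_pi:
  assumes z: "z \<in> admissible \<delta>"
  shows "\<exists>n. lyapunov ((se_step \<delta> 0 ^^ n) z) < 2 / pi"
proof (rule ccontr)
  define x where "x n = (se_step \<delta> 0 ^^ n) z" for n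
  define \<rho> where "\<rho> = (pi\<^sup>2 / 4 - 1) / \<delta>"
  assume "\<nexists>n. lyapunov ((se_step \<delta> 0 ^^ n) z) < 2 / pi"
  then have ge: "2 / pi \<le> lyapunov (x n)" for n by (auto simp: x_def not_less)
  have adm: "x n \<in> admissible \<delta>" for n unfolding x_def by (rule orbit_admissible[OF z])
  have snd_ge: "2 / pi \<le> snd (x n)" for n
    using ge[of n] nullcline_less[of "fst (x n)"] adm[of n]
    by (auto simp: lyapunov_def admissible_def max_def split: if_splits)
  have bound: "(snd (x n))\<^sup>2 \<le> \<rho> ^ n * (snd (x 0))\<^sup>2" for n
  proof (induction n)
    case (Suc n)
    have a: "0 < fst (x n)" "fst (x n) \<le> 1" "0 \<le> snd (x n)" using adm[of n] by (auto simp: admissible_def)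
    have "nullcline (fst (x n)) \<le> snd (x n)"
      using nullcline_less[OF a(1,2)] snd_ge[of n] by linarith
    then have "bracket (fst (x n)) (snd (x n)) \<le> (pi\<^sup>2 / 4 - 1) * (snd (x n))\<^sup>2"
      using bracket_above_nullcline a by blast
    then have "bracket (fst (x n)) (snd (x n)) / \<delta> \<le> (pi\<^sup>2 / 4 - 1) * (snd (x n))\<^sup>2 / \<delta>"
      using delta_pos by (intro divide_right_mono) auto
    then have "(snd (x (Suc n)))\<^sup>2 \<le> \<rho> * (snd (x n))\<^sup>2"
      using bracket_nonneg[OF a(1,3)] delta_pos by (simp add: x_def se_step_def \<rho>_def)
    also have "\<dots> \<le> \<rho> * (\<rho> ^ n * (snd (x 0))\<^sup>2)"
      using Suc delta_pos pi_sq_bounds by (intro mult_left_mono) (auto simp: \<rho>_def)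
    finally show ?case by simp
  qed simp
  have "\<rho> < 1" "0 \<le> \<rho>" using \<delta> delta_pos pi_sq_bounds by (auto simp: \<rho>_def)
  then have "(\<lambda>n. \<rho> ^ n * (snd (x 0))\<^sup>2) \<longlonglongrightarrow> 0 * (snd (x 0))\<^sup>2"
    by (intro tendsto_mult LIMSEQ_realpow_zero tendsto_const)
  moreover have "(2 / pi)\<^sup>2 \<le> \<rho> ^ n * (snd (x 0))\<^sup>2" for n
    using bound[of n] power_mono[OF snd_ge[of n], of 2] by simp
  ultimately have "(2 / pi)\<^sup>2 \<le> 0 * (snd (x 0))\<^sup>2"
    by (intro LIMSEQ_le_const) auto
  then show False by (simp add: power_divide)
qed

text \<open>Turns a bound V < 2/pi on the nullcline value into a positive lower bound for a.\<close>

lemma nullcline_ge: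
  assumes "0 < a" "a \<le> 1"
  shows "2 / pi * (1 - (pi * a / 2)\<^sup>2 / 2) \<le> nullcline a"
proof -
  define y where "y = pi * a / 2"
  have y: "0 < y" "y \<le> pi / 2" using assms by (auto simp: y_def)
  have "cos y = 1 - 2 * (sin (y / 2))\<^sup>2" using cos_double_sin[of "y / 2"] by simp
  moreover have "(sin (y / 2))\<^sup>2 \<le> (y / 2)\<^sup>2"
    using y by (intro power_mono sin_x_le_x sin_ge_zero) auto
  ultimately have "1 - y\<^sup>2 / 2 \<le> cos y" by (simp add: power_divide)
  then have "1 - y\<^sup>2 / 2 \<le> ycot y" using ycot_ge_cos[OF y] by simp
  then show ?thesis unfolding nullcline_def y_def by (intro mult_left_mono) auto
qed

lemma isCont_nullcline: "0 < a \<Longrightarrow> a \<le> 1 \<Longrightarrow> isCont nullcline a"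
proof -
  assume a: "0 < a" "a \<le> 1"
  have "isCont ycot (pi * a / 2)"
    using DERIV_ycot[of "pi * a / 2"] a by (intro DERIV_isCont) auto
  then have "isCont (\<lambda>a. ycot (pi * a / 2)) a"
    by (intro isCont_o2[where g = ycot and f = "\<lambda>a. pi * a / 2"]) (auto intro!: continuous_intros)
  then show ?thesis unfolding nullcline_def[abs_def] by (intro continuous_intros)
qed

lemma continuous_on_lyapunov: "continuous_on {z. 0 < fst z \<and> fst z \<le> 1} lyapunov"
proof -
  have "continuous_on {0<..1} nullcline"
    by (intro continuous_at_imp_continuous_on ballI isCont_nullcline) auto
  then have "continuous_on {z. 0 < fst z \<and> fst z \<le> 1} (\<lambda>z::real\<times>real. nullcline (fst z))"
    by (rule continuous_on_compose2) (auto intro!: continuous_intros)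
  then show ?thesis unfolding lyapunov_def[abs_def]
    by (intro continuous_intros)
qed

lemma continuous_on_se_step: "continuous_on {z. 0 < fst z} (se_step \<delta> w)"
  unfolding se_step_def[abs_def] next_alpha_def bracket_def
  by (intro continuous_intros) (use delta_pos in auto)

lemma orbit_lyapunov_small:
  assumes z: "z \<in> admissible \<delta>" and \<epsilon>: "0 < \<epsilon>"
  shows "\<exists>n. lyapunov ((se_step \<delta> 0 ^^ n) z) < \<epsilon>"
proof (rule ccontr)
  define x where "x n = (se_step \<delta> 0 ^^ n) z" for n
  have adm: "x n \<in> admissible \<delta>" for n unfolding x_def by (rule orbit_admissible[OF z])
  assume "\<nexists>n. lyapunov ((se_step \<delta> 0 ^^ n) z) < \<epsilon>"
  then have ge: "\<epsilon> \<le> lyapunov (x n)" for n by (auto simp: x_def not_less)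
  obtain n0 where n0: "lyapunov (x n0) < 2 / pi"
    using orbit_lyapunov_less_two_div_pi[OF z] by (auto simp: x_def)
  define V where "V = lyapunov (x n0)"
  have V: "0 < V" "V < 2 / pi" using ge[of n0] \<epsilon> n0 by (auto simp: V_def)
  \<comment> \<open>\<open>m\<close> solves 2/pi (1 - (pi m/2)^2 / 2) = V, the equality case of
    \<open>nullcline_ge\<close>.\<close>
  define m where "m = 2 / pi * sqrt (2 - pi * V)"
  have m: "0 < m" using V by (simp add: m_def field_simps)
  have m_le: "m \<le> a" if a: "0 < a" "a \<le> 1" "nullcline a \<le> V" for a
  proof -
    have "2 / pi * (1 - (pi * a / 2)\<^sup>2 / 2) \<le> V" using nullcline_ge[OF a(1,2)] a(3) by linarith
    then have "pi / 2 * (2 / pi * (1 - (pi * a / 2)\<^sup>2 / 2)) \<le> pi / 2 * V" by (intro mult_left_mono) auto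
    then have "2 - pi * V \<le> (pi * a / 2)\<^sup>2" by simp
    then have "sqrt (2 - pi * V) \<le> pi * a / 2"
      using a by (intro real_le_lsqrt) auto
    then show ?thesis by (simp add: m_def field_simps)
  qed
  define S where "S = {z. \<epsilon> \<le> lyapunov z \<and> bracket_min (fst z) \<le> \<delta> * (snd z)\<^sup>2}"
  define K where "K = ({m..1} \<times> {0..V}) \<inter> S"
  have K: "K \<subseteq> admissible \<delta>" using m by (auto simp: K_def S_def admissible_def)
  have "compact K"
  proof -
    have box: "{m..1} \<times> {0..V} \<subseteq> {z. 0 < fst z \<and> fst z \<le> 1}" using m by auto
    have "closed ({z \<in> {m..1} \<times> {0..V}. \<epsilon> \<le> lyapunov z} \<inter>
        {z \<in> {m..1} \<times> {0..V}. bracket_min (fst z) \<le> \<delta> * (snd z)\<^sup>2})"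
    proof (intro closed_Int continuous_on_closed_Collect_le)
      show "continuous_on ({m..1} \<times> {0..V}) lyapunov"
        using continuous_on_lyapunov box by (rule continuous_on_subset)
      show "continuous_on ({m..1} \<times> {0..V}) (\<lambda>z. bracket_min (fst z))"
        unfolding bracket_min_def by (intro continuous_intros) auto
    qed (auto intro!: continuous_intros closed_Times)
    also have "({z \<in> {m..1} \<times> {0..V}. \<epsilon> \<le> lyapunov z} \<inter>
        {z \<in> {m..1} \<times> {0..V}. bracket_min (fst z) \<le> \<delta> * (snd z)\<^sup>2}) = K"
      by (auto simp: K_def S_def)
    finally have "compact (({m..1} \<times> {0..V}) \<inter> K)"
      by (intro compact_Int_closed compact_Times) auto
    then show ?thesis by (simp add: K_def Int_assoc[symmetric])
  qed
  have inK: "x n \<in> K" if "n0 \<le> n" for n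
  proof -
    have "lyapunov (x n) \<le> V"
      using lyapunov_orbit_antimono[OF z that] by (simp add: x_def V_def)
    then have "snd (x n) \<le> V" "nullcline (fst (x n)) \<le> V" by (auto simp: lyapunov_def)
    then show ?thesis
      using adm[of n] ge[of n] m_le[of "fst (x n)"]
      by (cases "x n") (auto simp: K_def S_def admissible_def)
  qed
  \<comment> \<open>The two-step decrease is continuous and positive on the compact set
    \<open>K\<close>, so it has a positive minimum there. As the orbit stays in \<open>K\<close>
    from \<open>n0\<close> on, \<open>lyapunov\<close> would fall linearly below 0.\<close>
  define drop where "drop z = lyapunov z - lyapunov (se_step \<delta> 0 (se_step \<delta> 0 z))" for z
  have "continuous_on K drop"
  proof -
    let ?D = "{z :: real \<times> real. 0 < fst z \<and> fst z \<le> 1 \<and> 0 \<le> snd z}"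
    have inv: "se_step \<delta> 0 ` ?D \<subseteq> ?D"
      using se_step_admissible[OF delta_pos order_refl] by (force simp: admissible_def)
    have c1: "continuous_on ?D (se_step \<delta> 0)"
      by (rule continuous_on_subset[OF continuous_on_se_step]) auto
    have c2: "continuous_on ?D (\<lambda>z. se_step \<delta> 0 (se_step \<delta> 0 z))"
      by (rule continuous_on_compose2[OF c1 c1 inv])
    have c3: "continuous_on ?D lyapunov"
      by (rule continuous_on_subset[OF continuous_on_lyapunov]) auto
    have "continuous_on ?D (\<lambda>z. lyapunov (se_step \<delta> 0 (se_step \<delta> 0 z)))"
      by (rule continuous_on_compose2[OF c3 c2]) (use inv in blast)
    then have "continuous_on ?D drop"
      unfolding drop_def[abs_def] using c3 by (intro continuous_intros)
    then show ?thesis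
      by (rule continuous_on_subset) (use K in \<open>auto simp: admissible_def\<close>)
  qed
  then obtain z0 where z0: "z0 \<in> K" "\<And>z. z \<in> K \<Longrightarrow> drop z0 \<le> drop z"
    using continuous_attains_inf[OF \<open>compact K\<close>] inK[of n0] by blast
  have "0 < lyapunov z0" using z0(1) \<epsilon> by (auto simp: K_def S_def)
  then have e: "0 < drop z0"
    using lyapunov_se_step_se_step_less[of z0] K z0(1) by (auto simp: drop_def)
  have dec: "lyapunov (x (n0 + 2 * j)) \<le> V - real j * drop z0" for j
  proof (induction j)
    case (Suc j)
    have "drop z0 \<le> drop (x (n0 + 2 * j))" by (intro z0(2) inK) simp
    then have "lyapunov (x (n0 + 2 * Suc j)) \<le> lyapunov (x (n0 + 2 * j)) - drop z0"
      by (simp add: drop_def x_def)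
    then show ?case using Suc by (simp add: algebra_simps)
  qed (simp add: V_def)
  obtain j where "V < real j * drop z0" using ex_less_of_nat_mult[OF e] by auto
  then show False using dec[of j] ge[of "n0 + 2 * j"] \<epsilon> by linarith
qed

end

section \<open>Contraction near \<open>(1, 0)\<close>\<close>

text \<open>The derivative t^2 / (1 + t^2) of x - arctan x is at most M^2. Comparison with 0 gives
  the cubic bound that makes the arctan part of \<open>bracket\<close> a small correction.\<close>

lemma diff_arctan_lipschitz:
  fixes x y M :: real
  assumes "0 \<le> x" "x \<le> M" "0 \<le> y" "y \<le> M"
  shows "\<bar>(x - arctan x) - (y - arctan y)\<bar> \<le> M\<^sup>2 * \<bar>x - y\<bar>"
proof -
  have main: "\<bar>(v - arctan v) - (u - arctan u)\<bar> \<le> M\<^sup>2 * \<bar>v - u\<bar>" if u: "0 \<le> u" "u < v" "v \<le> M" for u v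
  proof -
    have D: "((\<lambda>x. x - arctan x) has_real_derivative 1 - inverse (1 + t\<^sup>2)) (at t)" for t
      by (auto intro!: derivative_eq_intros)
    obtain t where t: "u < t" "t < v" "(v - arctan v) - (u - arctan u) = (v - u) * (1 - inverse (1 + t\<^sup>2))"
      using MVT2[OF u(2), of "\<lambda>x. x - arctan x" "\<lambda>t. 1 - inverse (1 + t\<^sup>2)"] D by blast
    have p: "0 < 1 + t\<^sup>2" by (simp add: add_pos_nonneg)
    have "t\<^sup>2 / (1 + t\<^sup>2) \<le> t\<^sup>2" by (simp add: pos_divide_le_eq[OF p] algebra_simps)
    moreover have "t\<^sup>2 \<le> M\<^sup>2" using u t by (intro power_mono) auto
    moreover have "1 - inverse (1 + t\<^sup>2) = t\<^sup>2 / (1 + t\<^sup>2)" using p by (simp add: field_simps)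
    moreover have "0 \<le> t\<^sup>2 / (1 + t\<^sup>2)" using p by simp
    ultimately have "\<bar>1 - inverse (1 + t\<^sup>2)\<bar> \<le> M\<^sup>2" by linarith
    then show ?thesis unfolding t(3) abs_mult using u
      by (subst mult.commute) (intro mult_right_mono, auto)
  qed
  show ?thesis
    using main[of x y] main[of y x] assms
    by (cases x y rule: linorder_cases) (auto simp: abs_minus_commute)
qed

lemma diff_arctan_bounds:
  fixes x :: real
  assumes "0 \<le> x"
  shows "0 \<le> x - arctan x" "x - arctan x \<le> x\<^sup>2 * x"
  using diff_arctan_lipschitz[of x x 0] arctan_le_self[OF assms] assms by auto

lemma bracket_eq:
  "0 < a \<Longrightarrow> bracket a s = (1 - a)\<^sup>2 + s\<^sup>2 - 4 / pi * (a * (s / a - arctan (s / a)))"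
  by (simp add: bracket_def algebra_simps)

text \<open>The ratio \<open>2/3\<close> of the sides is chosen such that \<open>2/\<pi> < 2/3\<close> and \<open>1 + (2/3)\<^sup>2 < \<pi>\<^sup>2/4 - 1\<close>.\<close>

definition contraction_box :: "(real \<times> real) set" where
  "contraction_box = {1 - 1 / 1500..1} \<times> {0..1 / 1000}"

lemma box_ratio:
  assumes "(a, s) \<in> contraction_box"
  shows "0 < a" "a \<le> 1" "0 \<le> s" "s \<le> 1 / 1000" "0 \<le> s / a" "s / a \<le> (1001 / 1000) * s" "s / a \<le> (11 / 10000)"
proof -
  show a: "0 < a" "a \<le> 1" "0 \<le> s" "s \<le> 1 / 1000" using assms by (auto simp: contraction_box_def)
  show "0 \<le> s / a" using a by simp
  have "1 \<le> (1001 / 1000) * a" using assms by (auto simp: contraction_box_def)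
  then have "s * 1 \<le> s * ((1001 / 1000) * a)" using a by (intro mult_left_mono) auto
  then show "s / a \<le> (1001 / 1000) * s" using a by (simp add: pos_divide_le_eq mult_ac)
  also have "(1001 / 1000) * s \<le> (11 / 10000)" using a by simp
  finally show "s / a \<le> (11 / 10000)" .
qed

lemma pi_quotients: "4 / pi \<le> (1274 / 1000)" "2 / pi \<le> (637 / 1000)"
  using pi_approx by (auto simp: field_simps)

text \<open>The arctan correction is of order s x^2 with x = s/a, which in the box is below 0.3
  percent of s^2.\<close>

lemma bracket_box_bounds:
  assumes "(a, s) \<in> contraction_box"
  shows "(997 / 1000) * ((1 - a)\<^sup>2 + s\<^sup>2) \<le> bracket a s" "bracket a s \<le> (1 - a)\<^sup>2 + s\<^sup>2"
proof -
  note b = box_ratio[OF assms]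
  define x where "x = s / a"
  define E where "E = a * (x - arctan x)"
  have x: "0 \<le> x" "x \<le> (1001 / 1000) * s" "x \<le> (11 / 10000)" "s = a * x" using b by (auto simp: x_def)
  have "E \<le> a * (x\<^sup>2 * x)"
    unfolding E_def using diff_arctan_bounds[OF x(1)] b by (intro mult_left_mono) auto
  also have "\<dots> = s * x * x" using x(4) by (simp add: power2_eq_square)
  also have "\<dots> \<le> s * ((1001 / 1000) * s) * (11 / 10000)" using x b by (intro mult_mono) auto
  also have "\<dots> \<le> (2 / 1000) * s\<^sup>2" by (simp add: power2_eq_square)
  finally have "E \<le> (2 / 1000) * s\<^sup>2" .
  have "0 \<le> E" using b diff_arctan_bounds[OF x(1)] by (simp add: E_def)
  define Q where "Q = 4 / pi * E"
  have "Q \<le> (1274 / 1000) * ((2 / 1000) * s\<^sup>2)"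
    unfolding Q_def using pi_quotients \<open>0 \<le> E\<close> \<open>E \<le> (2 / 1000) * s\<^sup>2\<close> by (intro mult_mono) auto
  moreover have "0 \<le> Q" using \<open>0 \<le> E\<close> by (simp add: Q_def)
  moreover have "bracket a s = (1 - a)\<^sup>2 + s\<^sup>2 - Q"
    using bracket_eq b by (simp add: E_def x_def Q_def)
  moreover have "0 \<le> (1 - a)\<^sup>2" "0 \<le> s\<^sup>2" by auto
  ultimately show "(997 / 1000) * ((1 - a)\<^sup>2 + s\<^sup>2) \<le> bracket a s" "bracket a s \<le> (1 - a)\<^sup>2 + s\<^sup>2"
    unfolding distrib_left by - linarith+
qed

lemma one_minus_next_alpha_le:
  assumes "(a, s) \<in> contraction_box"
  shows "1 - next_alpha a s \<le> 2 / 3 * s"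
proof -
  note b = box_ratio[OF assms]
  have "2 / pi * arctan (s / a) \<le> (637 / 1000) * ((1001 / 1000) * s)"
    using pi_quotients order_trans[OF arctan_le_self[OF b(5)] b(6)] b(5)
    by (intro mult_mono) (auto simp del: zero_le_divide_iff)
  then show ?thesis using b by (simp add: next_alpha_def)
qed

context
  fixes \<delta> :: real
  assumes \<delta>: "pi\<^sup>2 / 4 - 1 < \<delta>"
begin

lemma delta_gt: "(1465 / 1000) < \<delta>"
  using \<delta> pi_sq_bounds by simp

lemma se_step_box:
  assumes z: "z \<in> contraction_box" and w: "0 \<le> w" "w \<le> 1 / 100000000"
  shows "se_step \<delta> w z \<in> contraction_box"
proof -
  obtain a s where [simp]: "z = (a, s)" by force
  have zb: "(a, s) \<in> contraction_box" using z by simp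
  note b = box_ratio[OF zb]
  have "(1 - a)\<^sup>2 \<le> (1 / 1500)\<^sup>2" "s\<^sup>2 \<le> (1 / 1000)\<^sup>2"
    using zb by (intro power_mono; force simp: contraction_box_def)+
  \<comment> \<open>The constant is (1/1500)^2 + (1/1000)^2. Division by \<delta> > 1465/1000 brings
    it below (1/1000)^2 with enough room for noise up to 10^-8.\<close>
  then have "bracket a s \<le> (13 / 9000000)"
    using bracket_box_bounds[OF zb] by (simp add: power2_eq_square)
  then have "bracket a s / \<delta> \<le> (13 / 9000000) / (1465 / 1000)"
    using delta_gt by (intro frac_le) auto
  then have "bracket a s / \<delta> + w \<le> (1 / 1000)\<^sup>2"
    using w by (simp add: power2_eq_square)
  then have "sqrt (bracket a s / \<delta> + w) \<le> 1 / 1000"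
    by (intro real_le_lsqrt) auto
  moreover have "0 \<le> bracket a s / \<delta> + w"
    using bracket_nonneg[OF b(1,3)] delta_gt w by simp
  ultimately show ?thesis
    using one_minus_next_alpha_le[OF zb] next_alpha_range[OF b(1,3)] b
    by (simp add: contraction_box_def se_step_def)
qed

text \<open>The distance is measured by the larger of 3/2 times the first difference and the second
  difference. The first coordinate contracts because 2/pi < 2/3. For the second, the brackets differ
  by about sqrt (13/9) N (R1 + R2), while R1 + R2 is at most about sqrt \<delta> (t1 + t2), so the
  factor is close to sqrt (13 / (9 \<delta>)) < 1. The rate does not depend on the noise.\<close>

lemma se_step_contraction:
  assumes z1: "(a1, s1) \<in> contraction_box" and z2: "(a2, s2) \<in> contraction_box" and w: "0 < w"
    and N: "\<bar>a1 - a2\<bar> \<le> 2 / 3 * N" "\<bar>s1 - s2\<bar> \<le> N"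
  shows "\<bar>fst (se_step \<delta> w (a1, s1)) - fst (se_step \<delta> w (a2, s2))\<bar> \<le> 2 / 3 * ((999 / 1000) * N)"
    and "\<bar>snd (se_step \<delta> w (a1, s1)) - snd (se_step \<delta> w (a2, s2))\<bar> \<le> (999 / 1000) * N"
proof -
  note b1 = box_ratio[OF z1] and b2 = box_ratio[OF z2]
  define x1 where "x1 = s1 / a1"
  define x2 where "x2 = s2 / a2"
  note b1' = b1[folded x1_def] and b2' = b2[folded x2_def]
  have N0: "0 \<le> N" using N by linarith
  have "1 / a1 \<le> (1001 / 1000)" using z1 by (auto simp: contraction_box_def field_simps)
  have dx: "\<bar>x1 - x2\<bar> \<le> (101 / 100) * N"
  proof -
    have "x1 - x2 = ((s1 - s2) + x2 * (a2 - a1)) * (1 / a1)"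
      using b1 b2 by (simp add: x1_def x2_def field_simps)
    moreover have "\<bar>x2 * (a2 - a1)\<bar> \<le> (11 / 10000) * (2 / 3 * N)"
      unfolding abs_mult using b2' N(1)[unfolded abs_minus_commute[of a1]] by (intro mult_mono) auto
    then have "\<bar>(s1 - s2) + x2 * (a2 - a1)\<bar> \<le> (1001 / 1000) * N" using N by linarith
    then have "\<bar>((s1 - s2) + x2 * (a2 - a1)) * (1 / a1)\<bar> \<le> (1001 / 1000) * N * (1001 / 1000)"
      unfolding abs_mult using \<open>1 / a1 \<le> (1001 / 1000)\<close> b1 N0 by (intro mult_mono) auto
    ultimately have "\<bar>x1 - x2\<bar> \<le> (1001 / 1000) * N * (1001 / 1000)" by (simp only:)
    then show ?thesis using N0 by linarith
  qed
  have "\<bar>arctan x1 - arctan x2\<bar> \<le> \<bar>x1 - x2\<bar>"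
  proof -
    have *: "arctan v - arctan u \<le> v - u" if uv: "u < v" for u v :: real
    proof -
      obtain t where "arctan v - arctan u = (v - u) * inverse (1 + t\<^sup>2)"
        using MVT2[OF uv, of arctan "\<lambda>t. inverse (1 + t\<^sup>2)"] DERIV_arctan by blast
      also have "\<dots> \<le> (v - u) * 1"
        using uv by (intro mult_left_mono) (auto simp: inverse_le_1_iff add_pos_nonneg)
      finally show ?thesis by simp
    qed
    show ?thesis
      using *[of x1 x2] *[of x2 x1] arctan_le_iff[of x1 x2] arctan_le_iff[of x2 x1]
      by (cases x1 x2 rule: linorder_cases) (auto simp: abs_le_iff)
  qed
  then have "2 / pi * \<bar>arctan x1 - arctan x2\<bar> \<le> (637 / 1000) * ((101 / 100) * N)"
    using dx pi_quotients by (intro mult_mono) auto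
  also have "\<dots> \<le> 2 / 3 * ((999 / 1000) * N)" using N0 by simp
  finally have *: "2 / pi * \<bar>arctan x1 - arctan x2\<bar> \<le> 2 / 3 * ((999 / 1000) * N)" .
  show "\<bar>fst (se_step \<delta> w (a1, s1)) - fst (se_step \<delta> w (a2, s2))\<bar> \<le> 2 / 3 * ((999 / 1000) * N)"
  proof -
    have "next_alpha a1 s1 - next_alpha a2 s2 = - (2 / pi * (arctan x1 - arctan x2))"
      unfolding next_alpha_def x1_def x2_def right_diff_distrib by linarith
    then have "\<bar>next_alpha a1 s1 - next_alpha a2 s2\<bar> = 2 / pi * \<bar>arctan x1 - arctan x2\<bar>"
      by (simp only: abs_minus_cancel abs_mult) simp
    then show ?thesis using * by (simp only: se_step_def fst_conv snd_conv)
  qed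
  define E where "E x = x - arctan x" for x :: real
  define M where "M = max x1 x2"
  have M: "0 \<le> M" "M \<le> (11 / 10000)" "M \<le> (1001 / 1000) * (s1 + s2)" using b1' b2' by (auto simp: M_def)
  have M2: "M\<^sup>2 \<le> (12 / 10000) * (s1 + s2)"
  proof -
    have "M * M \<le> (11 / 10000) * ((1001 / 1000) * (s1 + s2))" using M by (intro mult_mono) auto
    also have "\<dots> \<le> (12 / 10000) * (s1 + s2)" using b1 b2 by simp
    finally show ?thesis by (simp add: power2_eq_square)
  qed
  have E12: "\<bar>E x1 - E x2\<bar> \<le> (12 / 10000) * (s1 + s2) * ((101 / 100) * N)"
  proof -
    have "\<bar>E x1 - E x2\<bar> \<le> M\<^sup>2 * \<bar>x1 - x2\<bar>"
      unfolding E_def using b1' b2' by (intro diff_arctan_lipschitz) (auto simp: M_def)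
    also have "\<dots> \<le> (12 / 10000) * (s1 + s2) * ((101 / 100) * N)"
      using M2 dx b1 b2 by (intro mult_mono) auto
    finally show ?thesis .
  qed
  have E2: "0 \<le> E x2" "E x2 \<le> (12 / 10000) * (s1 + s2)"
  proof -
    show "0 \<le> E x2" unfolding E_def using b2' by (intro diff_arctan_bounds)
    have "E x2 \<le> x2\<^sup>2 * x2" unfolding E_def using b2' by (intro diff_arctan_bounds)
    also have "\<dots> \<le> M\<^sup>2 * 1" using b2' by (intro mult_mono power_mono) (auto simp: M_def)
    finally show "E x2 \<le> (12 / 10000) * (s1 + s2)" using M2 by simp
  qed
  have dE: "\<bar>4 / pi * (a1 * E x1 - a2 * E x2)\<bar> \<le> (3 / 1000) * ((s1 + s2) * N)"
  proof -
    define P where "P = (s1 + s2) * N"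
    have "\<bar>a1 * (E x1 - E x2)\<bar> \<le> 1 * ((12 / 10000) * (s1 + s2) * ((101 / 100) * N))"
      unfolding abs_mult using b1 E12 by (intro mult_mono) auto
    also have "1 * ((12 / 10000) * (s1 + s2) * ((101 / 100) * N)) = (1212 / 1000000) * P"
      by (simp add: P_def)
    finally have 1: "\<bar>a1 * (E x1 - E x2)\<bar> \<le> (1212 / 1000000) * P" .
    have "\<bar>(a1 - a2) * E x2\<bar> \<le> 2 / 3 * N * ((12 / 10000) * (s1 + s2))"
      unfolding abs_mult using N E2 N0 by (intro mult_mono) auto
    also have "2 / 3 * N * ((12 / 10000) * (s1 + s2)) = (8 / 10000) * P"
      by (simp add: P_def)
    finally have 2: "\<bar>(a1 - a2) * E x2\<bar> \<le> (8 / 10000) * P" .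
    have P0: "0 \<le> P"
      unfolding P_def by (intro mult_nonneg_nonneg add_nonneg_nonneg b1 b2 N0)
    have "a1 * E x1 - a2 * E x2 = a1 * (E x1 - E x2) + (a1 - a2) * E x2"
      by (simp add: algebra_simps)
    then have "\<bar>a1 * E x1 - a2 * E x2\<bar> \<le> (22 / 10000) * P" using 1 2 P0 by linarith
    then have "4 / pi * \<bar>a1 * E x1 - a2 * E x2\<bar> \<le> (1274 / 1000) * ((22 / 10000) * P)"
      using pi_quotients by (intro mult_mono) auto
    also have "\<dots> \<le> (3 / 1000) * P" using P0 by simp
    finally show ?thesis unfolding abs_mult[of "4 / pi"] P_def by simp
  qed
  define u1 where "u1 = 1 - a1"
  define u2 where "u2 = 1 - a2"
  have u: "0 \<le> u1" "0 \<le> u2" using b1 b2 by (auto simp: u1_def u2_def)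
  define F1 where "F1 = bracket a1 s1"
  define F2 where "F2 = bracket a2 s2"
  define R1 where "R1 = sqrt (u1\<^sup>2 + s1\<^sup>2)"
  define R2 where "R2 = sqrt (u2\<^sup>2 + s2\<^sup>2)"
  \<comment> \<open>Cauchy-Schwarz with the vector (2/3, 1), whose norm sqrt (13/9) is just below
    12019/10000.\<close>
  have cs: "2 / 3 * v + s \<le> (12019 / 10000) * sqrt (v\<^sup>2 + s\<^sup>2)" for v s :: real
  proof (rule power2_le_imp_le)
    have "(2 / 3 * v + s)\<^sup>2 + (v - 2 / 3 * s)\<^sup>2 = 13 / 9 * (v\<^sup>2 + s\<^sup>2)"
      by (simp add: power2_eq_square algebra_simps)
    then have "(2 / 3 * v + s)\<^sup>2 \<le> 13 / 9 * (v\<^sup>2 + s\<^sup>2)"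
      using zero_le_power2[of "v - 2 / 3 * s"] by linarith
    also have "\<dots> \<le> (12019 / 10000)\<^sup>2 * (v\<^sup>2 + s\<^sup>2)"
      by (intro mult_right_mono) (auto simp: power2_eq_square)
    finally show "(2 / 3 * v + s)\<^sup>2 \<le> ((12019 / 10000) * sqrt (v\<^sup>2 + s\<^sup>2))\<^sup>2"
      by (simp only: power_mult_distrib real_sqrt_pow2[OF sum_power2_ge_zero])
  qed auto
  have dF: "\<bar>F1 - F2\<bar> \<le> (120551 / 100000) * (N * (R1 + R2))"
  proof -
    have "F1 - F2 = (u1 - u2) * (u1 + u2) + (s1 - s2) * (s1 + s2) - 4 / pi * (a1 * E x1 - a2 * E x2)"
      unfolding F1_def F2_def bracket_eq[OF b1(1)] bracket_eq[OF b2(1)]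
      by (simp add: u1_def u2_def E_def x1_def x2_def algebra_simps power2_eq_square)
    moreover have "\<bar>(u1 - u2) * (u1 + u2)\<bar> \<le> 2 / 3 * N * (u1 + u2)"
      unfolding abs_mult using N(1)[unfolded abs_minus_commute[of a1]] u N0
      by (intro mult_mono) (auto simp: u1_def u2_def)
    moreover have "\<bar>(s1 - s2) * (s1 + s2)\<bar> \<le> N * (s1 + s2)"
      unfolding abs_mult using N b1(3) b2(3) N0 by (intro mult_mono) auto
    ultimately have "\<bar>F1 - F2\<bar> \<le> 2 / 3 * N * (u1 + u2) + N * (s1 + s2) + (3 / 1000) * ((s1 + s2) * N)"
      using dE by linarith
    also have "\<dots> \<le> (1003 / 1000) * (N * ((2 / 3 * u1 + s1) + (2 / 3 * u2 + s2)))"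
    proof -
      have "(1003 / 1000) * (N * ((2 / 3 * u1 + s1) + (2 / 3 * u2 + s2)))
        - (2 / 3 * N * (u1 + u2) + N * (s1 + s2) + (3 / 1000) * ((s1 + s2) * N)) = 2 / 1000 * (N * (u1 + u2))"
        by (simp add: field_simps)
      moreover have "0 \<le> 2 / 1000 * (N * (u1 + u2))" using N0 u by simp
      ultimately show ?thesis by linarith
    qed
    also have "\<dots> \<le> (1003 / 1000) * (N * ((12019 / 10000) * R1 + (12019 / 10000) * R2))"
      unfolding R1_def R2_def using N0 by (intro mult_left_mono add_mono cs) auto
    also have "\<dots> \<le> (120551 / 100000) * (N * (R1 + R2))"
    proof -
      have "0 \<le> N * (R1 + R2)" using N0 by (simp add: R1_def R2_def)
      moreover have "(1003 / 1000) * (N * ((12019 / 10000) * R1 + (12019 / 10000) * R2)) = (1003 / 1000) * (12019 / 10000) * (N * (R1 + R2))"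
        by (simp add: algebra_simps)
      ultimately show ?thesis by linarith
    qed
    finally show ?thesis .
  qed
  define t1 where "t1 = sqrt (F1 / \<delta> + w)"
  define t2 where "t2 = sqrt (F2 / \<delta> + w)"
  have F0: "0 \<le> F1" "0 \<le> F2" unfolding F1_def F2_def by (intro bracket_nonneg b1 b2)+
  have sqd: "(121 / 100) \<le> sqrt \<delta>"
    using delta_gt by (intro real_le_rsqrt) (simp add: power2_eq_square)
  have low: "(998 / 1000) * sqrt (v\<^sup>2 + s\<^sup>2) \<le> sqrt \<delta> * sqrt (F / \<delta> + w)"
    if "(997 / 1000) * (v\<^sup>2 + s\<^sup>2) \<le> F" for v s F :: real
  proof -
    have "(998 / 1000)\<^sup>2 * (v\<^sup>2 + s\<^sup>2) \<le> (997 / 1000) * (v\<^sup>2 + s\<^sup>2)"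
      by (intro mult_right_mono) (auto simp: power2_eq_square)
    also have "\<dots> \<le> F" by fact
    also have "F \<le> \<delta> * (F / \<delta> + w)" using delta_gt w by (simp add: distrib_left)
    finally have "sqrt ((998 / 1000)\<^sup>2 * (v\<^sup>2 + s\<^sup>2)) \<le> sqrt (\<delta> * (F / \<delta> + w))"
      by (rule real_sqrt_le_mono)
    then show ?thesis by (simp add: real_sqrt_mult)
  qed
  have "(998 / 1000) * (R1 + R2) \<le> sqrt \<delta> * (t1 + t2)"
    unfolding R1_def R2_def t1_def t2_def distrib_left
    by (intro add_mono low bracket_box_bounds(1)[OF z1, folded u1_def F1_def]
      bracket_box_bounds(1)[OF z2, folded u2_def F2_def])
  then have R12: "R1 + R2 \<le> sqrt \<delta> * (t1 + t2) / (998 / 1000)" by (simp add: field_simps)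
  \<comment> \<open>Positive noise keeps the square roots away from 0, so the difference of squares
    can be divided by t1 + t2.\<close>
  have tpos: "0 < t1" "0 < t2" using F0 delta_gt w by (auto simp: t1_def t2_def add_nonneg_pos)
  have "\<bar>t1 - t2\<bar> * (t1 + t2) = \<bar>F1 - F2\<bar> / \<delta>"
  proof -
    have "(t1 - t2) * (t1 + t2) = t1\<^sup>2 - t2\<^sup>2" by (simp add: algebra_simps power2_eq_square)
    also have "\<dots> = (F1 - F2) / \<delta>"
      using F0 delta_gt w by (simp add: t1_def t2_def diff_divide_distrib)
    finally have "\<bar>(t1 - t2) * (t1 + t2)\<bar> = \<bar>(F1 - F2) / \<delta>\<bar>" by simp
    then show ?thesis using tpos delta_gt by (simp add: abs_mult abs_divide)
  qed
  also have "\<dots> \<le> (120551 / 100000) * (N * (sqrt \<delta> * (t1 + t2) / (998 / 1000))) / \<delta>"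
  proof -
    have "N * (R1 + R2) \<le> N * (sqrt \<delta> * (t1 + t2) / (998 / 1000))"
      using R12 N0 by (intro mult_left_mono)
    then have "\<bar>F1 - F2\<bar> \<le> (120551 / 100000) * (N * (sqrt \<delta> * (t1 + t2) / (998 / 1000)))"
      using dF by linarith
    then show ?thesis using delta_gt by (intro divide_right_mono) auto
  qed
  also have "\<dots> = (120551 / 100000) / (998 / 1000) * N * (1 / sqrt \<delta>) * (t1 + t2)"
  proof -
    have "1 / sqrt \<delta> = sqrt \<delta> / \<delta>"
      using delta_gt by (simp add: real_div_sqrt field_simps)
    then show ?thesis by (simp only:) simp
  qed
  finally have "\<bar>t1 - t2\<bar> \<le> (120551 / 100000) / (998 / 1000) * N * (1 / sqrt \<delta>)"
    by (rule mult_right_le_imp_le) (use tpos in simp)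
  also have "\<dots> \<le> (120551 / 100000) / (998 / 1000) * N * (1 / (121 / 100))"
    using N0 sqd delta_gt by (intro mult_left_mono divide_left_mono) auto
  \<comment> \<open>Numerically 1.20551 / (0.998 * 1.21) is about 0.9983.\<close>
  also have "\<dots> \<le> (999 / 1000) * N" using N0 by simp
  finally show "\<bar>snd (se_step \<delta> w (a1, s1)) - snd (se_step \<delta> w (a2, s2))\<bar> \<le> (999 / 1000) * N"
    by (simp add: se_step_def t1_def t2_def F1_def F2_def)
qed

end

section \<open>Limits of the noisy orbits\<close>

lemma convergent_geometric_increments:
  fixes f :: "nat \<Rightarrow> real"
  assumes "\<And>n. \<bar>f (Suc n) - f n\<bar> \<le> C * k ^ n" "0 \<le> k" "k < 1"
  shows "convergent f"
proof -
  have "summable (\<lambda>n. C * k ^ n)"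
    using assms(2,3) by (intro summable_mult summable_geometric) auto
  then have "summable (\<lambda>n. f (Suc n) - f n)"
    by (rule summable_comparison_test[rotated]) (use assms(1) in auto)
  then have "convergent (\<lambda>n. \<Sum>i<n. f (Suc i) - f i)"
    by (simp add: summable_iff_convergent)
  then have "convergent (\<lambda>n. f n - f 0)"
    by (simp add: sum_lessThan_telescope)
  then have "convergent (\<lambda>n. (f n - f 0) + f 0)"
    by (intro convergent_add convergent_const)
  then show ?thesis by simp
qed

context
  fixes \<delta> :: real
  assumes \<delta>: "pi\<^sup>2 / 4 - 1 < \<delta>"
begin

lemma box_orbit_converges:
  assumes z: "z \<in> contraction_box" and w: "0 < w" "w \<le> 1 / 100000000"
  obtains a s where "(\<lambda>n. (se_step \<delta> w ^^ n) z) \<longlonglongrightarrow> (a, s)" "(a, s) \<in> contraction_box"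
    "se_step \<delta> w (a, s) = (a, s)"
proof -
  define x where "x n = (se_step \<delta> w ^^ n) z" for n
  have xb: "x n \<in> contraction_box" for n
    unfolding x_def by (induction n) (use z w in \<open>auto intro: se_step_box[OF \<delta>]\<close>)
  have xS: "x (Suc n) = se_step \<delta> w (x n)" for n by (simp add: x_def)
  have d: "\<bar>fst (x (Suc n)) - fst (x n)\<bar> \<le> 2 / 3 * (999 / 1000) ^ n \<and>
      \<bar>snd (x (Suc n)) - snd (x n)\<bar> \<le> (999 / 1000) ^ n" for n
  proof (induction n)
    case 0
    have "x 0 \<in> contraction_box" "x (Suc 0) \<in> contraction_box" by (rule xb)+
    then show ?case by (auto simp: contraction_box_def abs_if)
  next
    case (Suc n)
    show ?case
      using se_step_contraction[OF \<delta>, of "fst (x (Suc n))" "snd (x (Suc n))" "fst (x n)" "snd (x n)" w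
          "(999 / 1000) ^ n"] xb[of n] xb[of "Suc n"] Suc w(1)
      by (simp add: xS[of "Suc n"] xS[of n])
  qed
  have "convergent (\<lambda>n. fst (x n))"
    by (rule convergent_geometric_increments[of _ "2 / 3" "999 / 1000"]) (use d in auto)
  then obtain a where a: "(\<lambda>n. fst (x n)) \<longlonglongrightarrow> a" by (auto simp: convergent_def)
  have "convergent (\<lambda>n. snd (x n))"
    by (rule convergent_geometric_increments[of _ 1 "999 / 1000"]) (use d in auto)
  then obtain s where s: "(\<lambda>n. snd (x n)) \<longlonglongrightarrow> s" by (auto simp: convergent_def)
  have lim: "x \<longlonglongrightarrow> (a, s)"
    using tendsto_Pair[OF a s] by simp
  have "closed contraction_box" unfolding contraction_box_def by (intro closed_Times) auto
  then have lim_mem: "(a, s) \<in> contraction_box"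
    using lim xb by (auto intro: Lim_in_closed_set[of _ x sequentially])
  have "isCont (se_step \<delta> w) (a, s)"
  proof -
    have "open {z :: real \<times> real. 0 < fst z}"
      by (intro open_Collect_less continuous_intros)
    then show ?thesis
      using continuous_on_se_step[OF \<delta>, of w] box_ratio(1)[OF lim_mem]
      by (auto simp: continuous_on_eq_continuous_at)
  qed
  then have "(\<lambda>n. se_step \<delta> w (x n)) \<longlonglongrightarrow> se_step \<delta> w (a, s)"
    using lim by (rule isCont_tendsto_compose)
  then have "(\<lambda>n. x (Suc n)) \<longlonglongrightarrow> se_step \<delta> w (a, s)" by (simp add: xS)
  then have "x \<longlonglongrightarrow> se_step \<delta> w (a, s)" by (simp add: filterlim_sequentially_Suc)
  then have "se_step \<delta> w (a, s) = (a, s)" using lim by (rule LIMSEQ_unique)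
  then show ?thesis using that lim lim_mem unfolding x_def by blast
qed

section \<open>Continuity in the noise level and entry into the contraction box\<close>

lemma tendsto_se_step_noise:
  assumes "(f \<longlongrightarrow> z) (at_right 0)" "0 < fst z"
  shows "((\<lambda>w. se_step \<delta> w (f w)) \<longlongrightarrow> se_step \<delta> 0 z) (at_right 0)"
proof -
  have 1: "((\<lambda>w. fst (f w)) \<longlongrightarrow> fst z) (at_right 0)" "((\<lambda>w. snd (f w)) \<longlongrightarrow> snd z) (at_right 0)"
    by (intro tendsto_fst tendsto_snd assms)+
  have 2: "((\<lambda>w. arctan (snd (f w) / fst (f w))) \<longlongrightarrow> arctan (snd z / fst z)) (at_right 0)"
    using assms(2) by (intro tendsto_arctan tendsto_divide 1) simp
  have "((\<lambda>w. bracket (fst (f w)) (snd (f w)) / \<delta> + w) \<longlongrightarrow> bracket (fst z) (snd z) / \<delta> + 0) (at_right 0)"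
    unfolding bracket_def
    by (intro tendsto_add tendsto_diff tendsto_mult tendsto_divide tendsto_power tendsto_const
        tendsto_ident_at 1 2) (use delta_pos[OF \<delta>] in simp)
  then show ?thesis
    unfolding se_step_def next_alpha_def
    by (intro tendsto_Pair tendsto_real_sqrt tendsto_diff tendsto_mult tendsto_const 2)
qed

lemma fst_orbit_pos:
  assumes "0 < fst z" "0 \<le> snd z" "0 \<le> w"
  shows "0 < fst ((se_step \<delta> w ^^ n) z) \<and> 0 \<le> snd ((se_step \<delta> w ^^ n) z)"
proof (induction n)
  case (Suc n)
  then have "(se_step \<delta> w ^^ Suc n) z \<in> admissible \<delta>"
    using se_step_admissible[OF delta_pos[OF \<delta>] assms(3), of "(se_step \<delta> w ^^ n) z"] by simp
  then show ?case unfolding admissible_def by blast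
qed (use assms in auto)

lemma tendsto_orbit_noise:
  assumes "0 < fst z" "0 \<le> snd z"
  shows "((\<lambda>w. (se_step \<delta> w ^^ n) z) \<longlongrightarrow> (se_step \<delta> 0 ^^ n) z) (at_right 0)"
proof (induction n)
  case (Suc n)
  then show ?case
    using tendsto_se_step_noise fst_orbit_pos[OF assms order_refl, of n] by simp
qed simp

lemma orbit_enters_box:
  assumes z: "0 < fst z" "0 \<le> snd z"
  shows "\<exists>n. eventually (\<lambda>w. (se_step \<delta> w ^^ n) z \<in> contraction_box) (at_right 0)"
proof -
  \<comment> \<open>One step is taken first because the initial point may have a > 1 or violate the
    constraint in \<open>admissible\<close>.\<close>
  define z1 where "z1 = se_step \<delta> 0 z"
  have z1: "z1 \<in> admissible \<delta>"
    unfolding z1_def by (rule se_step_admissible[OF delta_pos[OF \<delta>] order_refl z])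
  define a1 where "a1 = (1 - 1 / 1500 :: real)"
  have "0 < nullcline a1" by (intro nullcline_pos) (auto simp: a1_def)
  then obtain n where n: "lyapunov ((se_step \<delta> 0 ^^ n) z1) < min (1 / 1000) (nullcline a1)"
    using orbit_lyapunov_small[OF \<delta> z1, of "min (1 / 1000) (nullcline a1)"] by auto
  define y where "y = (se_step \<delta> 0 ^^ n) z1"
  have y: "y \<in> admissible \<delta>" unfolding y_def by (rule orbit_admissible[OF \<delta> z1])
  have yeq: "y = (se_step \<delta> 0 ^^ Suc n) z"
    by (simp add: y_def z1_def funpow_swap1)
  have "snd y < 1 / 1000" "nullcline (fst y) < nullcline a1"
    using n by (auto simp: lyapunov_def y_def)
  moreover have "a1 < fst y"
  proof (rule ccontr)
    assume "\<not> a1 < fst y"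
    then have "fst y < a1 \<or> fst y = a1" by linarith
    moreover have "0 < fst y" "a1 \<le> 1" using y by (auto simp: admissible_def a1_def)
    ultimately have "nullcline a1 \<le> nullcline (fst y)"
      using nullcline_strict_antimono[of "fst y" a1] by fastforce
    then show False using \<open>nullcline (fst y) < nullcline a1\<close> by simp
  qed
  \<comment> \<open>The noise-free orbit enters an open set at a fixed time, so orbits with small
    noise are in it at the same time. The two remaining sides of the box, a \<le> 1 and s \<ge> 0,
    come from admissibility.\<close>
  ultimately have "y \<in> {a1<..} \<times> {..<1 / 1000}" unfolding mem_Times_iff by simp
  moreover have "open ({a1<..} \<times> {..<1 / 1000 :: real})" by (intro open_Times) auto
  ultimately have "eventually (\<lambda>w. (se_step \<delta> w ^^ Suc n) z \<in> {a1<..} \<times> {..<1 / 1000}) (at_right 0)"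
    unfolding yeq by (intro topological_tendstoD[OF tendsto_orbit_noise[OF z, of "Suc n"]])
  moreover have "eventually (\<lambda>w::real. 0 < w) (at_right 0)"
    by (rule eventually_at_right_less)
  ultimately have "eventually (\<lambda>w. (se_step \<delta> w ^^ Suc n) z \<in> contraction_box) (at_right 0)"
  proof eventually_elim
    case (elim w)
    have "(se_step \<delta> w ^^ Suc n) z \<in> admissible \<delta>"
      using se_step_admissible[OF delta_pos[OF \<delta>], of w "(se_step \<delta> w ^^ n) z"]
        fst_orbit_pos[OF z, of w n] elim(2) by simp
    then show ?case using elim(1)
      unfolding contraction_box_def admissible_def a1_def mem_Times_iff mem_Collect_eq
      by (meson atLeastAtMost_iff greaterThan_iff lessThan_iff less_imp_le)
  qed
  then show ?thesis by blast
qed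

section \<open>Expansion of the fixed point for small noise\<close>

lemma fixed_point_bounds:
  assumes z: "(a, s) \<in> contraction_box" and w: "0 < w" and fp: "se_step \<delta> w (a, s) = (a, s)"
  shows "0 < s" "1 - a = 2 / pi * arctan (s / a)" "1 - a \<le> 2 / 3 * s"
    and "\<delta> * w = \<delta> * s\<^sup>2 - bracket a s" "(\<delta> - 13 / 9) * s\<^sup>2 \<le> \<delta> * w"
proof -
  note b = box_ratio[OF z]
  have \<delta>0: "0 < \<delta>" by (rule delta_pos[OF \<delta>])
  have next_a: "next_alpha a s = a" and s_eq: "sqrt (bracket a s / \<delta> + w) = s"
    using fp unfolding se_step_def by simp_all
  have F0: "0 \<le> bracket a s" by (intro bracket_nonneg b)
  have s2: "s\<^sup>2 = bracket a s / \<delta> + w"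
    using F0 \<delta>0 w by (subst s_eq[symmetric]) simp
  have "0 < s\<^sup>2" using F0 \<delta>0 w unfolding s2 by (simp add: add_nonneg_pos)
  then show "0 < s" using b(3) by (cases "s = 0") auto
  show "1 - a = 2 / pi * arctan (s / a)" using next_a by (simp add: next_alpha_def)
  show u: "1 - a \<le> 2 / 3 * s"
    using one_minus_next_alpha_le[OF z] next_a by simp
  show \<delta>w: "\<delta> * w = \<delta> * s\<^sup>2 - bracket a s"
    unfolding s2 using \<delta>0 by (simp add: field_simps)
  have "(1 - a)\<^sup>2 \<le> (2 / 3 * s)\<^sup>2" using u b(2) by (intro power_mono) auto
  \<comment> \<open>Here 13/9 = 1 + (2/3)^2. Since \<delta> > 13/9, the final bound makes s of order
    sqrt w.\<close>
  then have "bracket a s \<le> 13 / 9 * s\<^sup>2"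
    using bracket_box_bounds(2)[OF z] by (simp add: power_mult_distrib power_divide)
  then show "(\<delta> - 13 / 9) * s\<^sup>2 \<le> \<delta> * w" using \<delta>w by (simp add: left_diff_distrib)
qed

text \<open>Divided by s^2, the second fixed point equation reads \<delta> w / s^2 = \<delta> - 1 -
  U^2 + 4 E/pi, and the error over s^2 is U^2 + 1. The first equation gives U \<rightarrow> 2/pi,
  and the cubic bound gives E \<rightarrow> 0.\<close>

lemma fixed_point_asymptotics:
  assumes ev: "eventually (\<lambda>w. (A w, S w) \<in> contraction_box \<and> se_step \<delta> w (A w, S w) = (A w, S w)) (at_right 0)"
  shows "((\<lambda>w. ((1 - A w)\<^sup>2 + (S w)\<^sup>2) / w) \<longlongrightarrow> 1 / (inverse (1 + 4 / pi\<^sup>2) - 1 / \<delta>)) (at_right 0)"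
proof -
  define G where "G = at_right (0::real)"
  define X where "X w = S w / A w" for w
  define E where "E w = A w * (X w - arctan (X w)) / (S w)\<^sup>2" for w
  define U where "U w = (1 - A w) / S w" for w
  have \<delta>0: "0 < \<delta>" "13 / 9 < \<delta>" using delta_gt[OF \<delta>] by auto
  define C where "C = \<delta> / (\<delta> - 13 / 9)"
  have ev': "eventually (\<lambda>w. (A w, S w) \<in> contraction_box \<and> se_step \<delta> w (A w, S w) = (A w, S w) \<and> 0 < w) G"
    using ev eventually_at_right_less[of 0] unfolding G_def by eventually_elim auto
  have ev2: "eventually (\<lambda>w. 0 < w \<and> 0 < A w \<and> 0 < S w \<and> A w * X w = S w \<and> 0 < X w \<and> X w \<le> 2 * S w
      \<and> 1 - A w = 2 / pi * arctan (X w) \<and> 0 \<le> 1 - A w \<and> 1 - A w \<le> S w \<and> 1 / 2 \<le> A w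
      \<and> \<delta> * w = (\<delta> - 1 - (U w)\<^sup>2 + 4 / pi * E w) * (S w)\<^sup>2 \<and> S w \<le> sqrt (C * w)) G"
    using ev'
  proof eventually_elim
    case (elim w)
    have z: "(A w, S w) \<in> contraction_box" and w: "0 < w"
      and fp: "se_step \<delta> w (A w, S w) = (A w, S w)"
      using elim by blast+
    note b = box_ratio[OF z, folded X_def] and f = fixed_point_bounds[OF z w fp, folded X_def]
    have X: "A w * X w = S w" using b(1) by (simp add: X_def)
    have Xpos: "0 < X w" using b(1) f(1) by (simp add: X_def)
    have u: "0 \<le> 1 - A w" "1 - A w \<le> S w" "1 / 2 \<le> A w" "X w \<le> 2 * S w"
      using b(2-4,6) f(1,3) by linarith+
    have "bracket (A w) (S w) = (1 - A w)\<^sup>2 + (S w)\<^sup>2 - 4 / pi * (A w * (X w - arctan (X w)))"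
      unfolding X_def by (rule bracket_eq[OF b(1)])
    moreover have "A w * (X w - arctan (X w)) = E w * (S w)\<^sup>2"
      using f(1) by (simp add: E_def)
    moreover have "(1 - A w)\<^sup>2 = (U w)\<^sup>2 * (S w)\<^sup>2"
      using f(1) by (simp add: U_def power_divide)
    ultimately have eq: "\<delta> * w = (\<delta> - 1 - (U w)\<^sup>2 + 4 / pi * E w) * (S w)\<^sup>2"
      unfolding f(4) by (simp add: distrib_right left_diff_distrib)
    have "(S w)\<^sup>2 \<le> C * w"
      using f(5) \<delta>0 by (simp add: C_def pos_le_divide_eq mult.commute)
    then have "S w \<le> sqrt (C * w)" by (rule real_le_rsqrt)
    then show ?case by (intro conjI w b(1) f(1,2) X Xpos u eq)
  qed
  have "((\<lambda>w. sqrt (C * w)) \<longlongrightarrow> sqrt (C * 0)) G"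
    unfolding G_def by (intro tendsto_intros)
  then have rt: "((\<lambda>w. sqrt (C * w)) \<longlongrightarrow> 0) G" by simp
  have evs: "eventually (\<lambda>w. 0 \<le> S w) G" "eventually (\<lambda>w. S w \<le> sqrt (C * w)) G"
    "eventually (\<lambda>w. 0 \<le> X w) G" "eventually (\<lambda>w. X w \<le> 2 * S w) G"
    "eventually (\<lambda>w. 0 \<le> 1 - A w) G" "eventually (\<lambda>w. 1 - A w \<le> S w) G"
    "eventually (\<lambda>w. X w \<noteq> 0) G"
    using ev2 by (eventually_elim, blast intro: less_imp_le dest: less_imp_neq[THEN not_sym])+
  have S0: "(S \<longlongrightarrow> 0) G"
    by (rule tendsto_sandwich[OF evs(1,2) tendsto_const rt])
  have X0: "(X \<longlongrightarrow> 0) G"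
    by (rule tendsto_sandwich[OF evs(3,4) tendsto_const tendsto_mult_right_zero[OF S0]])
  have "((\<lambda>w. 1 - A w) \<longlongrightarrow> 0) G"
    by (rule tendsto_sandwich[OF evs(5,6) tendsto_const S0])
  then have "((\<lambda>w. 1 - (1 - A w)) \<longlongrightarrow> 1 - 0) G" by (intro tendsto_intros)
  then have A1: "(A \<longlongrightarrow> 1) G" by simp
  have "filterlim X (at 0) G"
    using X0 evs(7) unfolding filterlim_at by auto
  moreover have "((\<lambda>x. arctan x / x) \<longlongrightarrow> 1) (at (0::real))"
    using DERIV_arctan[of 0] by (simp add: has_field_derivative_iff)
  ultimately have "((\<lambda>w. arctan (X w) / X w) \<longlongrightarrow> 1) G"
    by (rule filterlim_compose[rotated])
  then have "((\<lambda>w. 2 / pi * (arctan (X w) / X w) / A w) \<longlongrightarrow> 2 / pi * 1 / 1) G"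
    using A1 by (intro tendsto_intros) auto
  moreover have "eventually (\<lambda>w. 2 / pi * (arctan (X w) / X w) / A w = U w) G"
    using ev2
  proof eventually_elim
    case (elim w)
    then have e: "A w * X w = S w" "1 - A w = 2 / pi * arctan (X w)" by blast+
    have "2 / pi * (arctan (X w) / X w) / A w = 2 / pi * arctan (X w) / (A w * X w)" by simp
    also have "\<dots> = (1 - A w) / S w" unfolding e ..
    finally show ?case by (simp add: U_def)
  qed
  ultimately have "(U \<longlongrightarrow> 2 / pi * 1 / 1) G"
    by (rule Lim_transform_eventually)
  then have U: "(U \<longlongrightarrow> 2 / pi) G" by simp
  have "(E \<longlongrightarrow> 0) G"
  proof (rule tendsto_sandwich[of "\<lambda>_. 0" E G "\<lambda>w. 2 * X w"])
    show "eventually (\<lambda>w. 0 \<le> E w) G" using ev2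
    proof eventually_elim
      case (elim w)
      then have "0 \<le> X w" "0 \<le> A w" by (blast intro: less_imp_le)+
      then show ?case unfolding E_def
        by (intro divide_nonneg_nonneg mult_nonneg_nonneg diff_arctan_bounds(1)) auto
    qed
    show "eventually (\<lambda>w. E w \<le> 2 * X w) G" using ev2
    proof eventually_elim
      case (elim w)
      then have p: "0 < A w" "0 < X w" "1 / 2 \<le> A w" and e: "S w = A w * X w" by simp_all
      have "A w * (X w - arctan (X w)) \<le> A w * ((X w)\<^sup>2 * X w)"
        using p diff_arctan_bounds(2)[of "X w"] by (intro mult_left_mono) auto
      then have "E w \<le> A w * ((X w)\<^sup>2 * X w) / (S w)\<^sup>2"
        unfolding E_def by (intro divide_right_mono) auto
      also have "\<dots> = X w / A w"
        using p unfolding e by (simp add: power2_eq_square)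
      also have "\<dots> \<le> 2 * X w"
      proof -
        have "X w * 1 \<le> X w * (2 * A w)" using p by (intro mult_left_mono) auto
        then show ?thesis using p(1) by (simp add: pos_divide_le_eq mult_ac)
      qed
      finally show ?case .
    qed
    show "((\<lambda>w. 2 * X w) \<longlongrightarrow> 0) G" using tendsto_mult_right_zero[OF X0] by simp
  qed auto
  \<comment> \<open>This makes the limiting denominator \<delta> - 1 - 4/pi^2 positive, since
    \<delta> > 13/9.\<close>
  have q: "4 / pi\<^sup>2 < 4 / 9" using pi_sq_bounds by (simp add: field_simps)
  have den: "\<delta> - 1 - (2 / pi)\<^sup>2 + 4 / pi * 0 \<noteq> 0"
    using q \<delta>0 by (simp add: power_divide)
  have lim: "((\<lambda>w. \<delta> * ((U w)\<^sup>2 + 1) / (\<delta> - 1 - (U w)\<^sup>2 + 4 / pi * E w)) \<longlongrightarrow>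
      \<delta> * ((2 / pi)\<^sup>2 + 1) / (\<delta> - 1 - (2 / pi)\<^sup>2 + 4 / pi * 0)) G"
    by (intro tendsto_intros U \<open>(E \<longlongrightarrow> 0) G\<close> den)
  have "eventually (\<lambda>w. \<delta> * ((U w)\<^sup>2 + 1) / (\<delta> - 1 - (U w)\<^sup>2 + 4 / pi * E w) = ((1 - A w)\<^sup>2 + (S w)\<^sup>2) / w) G"
    using ev2
  proof eventually_elim
    case (elim w)
    define D where "D = \<delta> - 1 - (U w)\<^sup>2 + 4 / pi * E w"
    have S: "0 < S w" and w: "0 < w" and D: "\<delta> * w = D * (S w)\<^sup>2" using elim unfolding D_def by blast+
    have "(1 - A w)\<^sup>2 + (S w)\<^sup>2 = ((U w)\<^sup>2 + 1) * (S w)\<^sup>2"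
      using S by (simp add: U_def power_divide distrib_right)
    then have "((1 - A w)\<^sup>2 + (S w)\<^sup>2) / w = \<delta> * (((U w)\<^sup>2 + 1) * (S w)\<^sup>2) / (\<delta> * w)"
      using \<delta>0 by simp
    also have "\<dots> = \<delta> * ((U w)\<^sup>2 + 1) / D"
      unfolding D using S by simp
    finally show ?case by (simp add: D_def)
  qed
  with lim have "((\<lambda>w. ((1 - A w)\<^sup>2 + (S w)\<^sup>2) / w) \<longlongrightarrow>
      \<delta> * ((2 / pi)\<^sup>2 + 1) / (\<delta> - 1 - (2 / pi)\<^sup>2 + 4 / pi * 0)) G"
    by (rule Lim_transform_eventually)
  moreover have "\<delta> * ((2 / pi)\<^sup>2 + 1) / (\<delta> - 1 - (2 / pi)\<^sup>2 + 4 / pi * 0)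
      = 1 / (inverse (1 + 4 / pi\<^sup>2) - 1 / \<delta>)"
  proof -
    have "\<delta> * (q + 1) / (\<delta> - 1 - q) = 1 / (inverse (1 + q) - 1 / \<delta>)" if "0 \<le> q" "1 + q < \<delta>" for q
    proof -
      have "inverse (1 + q) - 1 / \<delta> = (\<delta> - 1 - q) / (\<delta> * (q + 1))"
        using that \<delta>0(1) by (simp add: field_simps)
      then show ?thesis by simp
    qed
    from this[of "4 / pi\<^sup>2"] have "\<delta> * (4 / pi\<^sup>2 + 1) / (\<delta> - 1 - 4 / pi\<^sup>2)
        = 1 / (inverse (1 + 4 / pi\<^sup>2) - 1 / \<delta>)"
      using q \<delta>0(2) by fastforce
    then show ?thesis by (simp add: power_divide)
  qed
  ultimately show ?thesis by (simp add: G_def)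
qed

end

section \<open>Transfer to the state evolution sequences\<close>

lemma psi_eq:
  assumes "0 < a" "0 \<le> s"
  shows "psi1 a (s\<^sup>2) = next_alpha a s"
    and "psi2 a (s\<^sup>2) \<delta> w = bracket a s / \<delta> + w"
proof -
  \<comment> \<open>At s = 0 the convention yields pi/2, in agreement with arctan 0 = 0.\<close>
  have at: "atan_ratio a s = pi / 2 - arctan (s / a)"
    using assms arctan_inverse[of "s / a"] by (auto simp: atan_ratio_def)
  show "psi1 a (s\<^sup>2) = next_alpha a s"
    using assms by (simp add: psi1_def next_alpha_def at right_diff_distrib)
  show "psi2 a (s\<^sup>2) \<delta> w = bracket a s / \<delta> + w"
  proof -
    have "4 * a / pi * (pi / 2 - arctan (s / a)) = 2 * a - 4 / pi * (a * arctan (s / a))"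
      by (simp add: field_simps)
    then have "a\<^sup>2 + s\<^sup>2 + 1 - 4 * s / pi - 4 * a / pi * atan_ratio a s = bracket a s"
      by (simp add: bracket_def at power2_diff right_diff_distrib)
    then show ?thesis
      using assms by (simp add: psi2_def)
  qed
qed

lemma SE_eq_orbit:
  assumes "0 < \<delta>" "0 \<le> w" "0 < a0" "0 \<le> s0"
  defines "y n \<equiv> (se_step \<delta> w ^^ n) (a0, sqrt s0)"
  shows "SE \<delta> w a0 s0 n = (fst (y n), (snd (y n))\<^sup>2) \<and> 0 < fst (y n) \<and> 0 \<le> snd (y n)"
proof (induction n)
  case 0
  then show ?case using assms by simp
next
  case (Suc n)
  then have pos: "0 < fst (y n)" "0 \<le> snd (y n)" by auto
  have yS: "y (Suc n) = se_step \<delta> w (y n)" by (simp add: y_def)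
  have "y (Suc n) \<in> admissible \<delta>"
    unfolding yS using assms(1,2) pos by (rule se_step_admissible)
  moreover have "0 \<le> bracket (fst (y n)) (snd (y n)) / \<delta> + w"
    using bracket_nonneg[OF pos] assms(1,2) by simp
  ultimately show ?case
    using Suc pos by (simp add: yS psi_eq se_step_def admissible_def)
qed

lemma atan_ratio_uminus: "atan_ratio (- a) s = - atan_ratio a s"
  by (simp add: atan_ratio_def arctan_minus sgn_minus)

text \<open>\<open>psi1\<close> is odd and \<open>psi2\<close> even in the first argument; this
  reduces everything to a positive start.\<close>

lemma SE_uminus: "SE \<delta> w (- a0) s0 n = (- fst (SE \<delta> w a0 s0 n), snd (SE \<delta> w a0 s0 n))"
proof (induction n)
  case (Suc n)
  obtain a s2 where as: "SE \<delta> w a0 s0 n = (a, s2)" by force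
  have "psi1 (- a) s2 = - psi1 a s2" "psi2 (- a) s2 \<delta> w = psi2 a s2 \<delta> w"
    by (simp_all add: psi1_def psi2_def atan_ratio_uminus)
  then show ?case using Suc by (simp add: as)
qed simp

lemma mse_seq_uminus: "mse_seq \<delta> w (- a0) s0 = mse_seq \<delta> w a0 s0"
  by (rule ext) (simp add: mse_seq_def SE_uminus split_def Let_def)

lemma mse_seq_limit_asymptotics:
  assumes \<delta>: "pi\<^sup>2 / 4 - 1 < \<delta>" and a0: "0 < a0" and s0: "0 \<le> s0"
  shows "eventually (\<lambda>w. convergent (mse_seq \<delta> w a0 s0)) (at_right 0)"
    and "((\<lambda>w. AMSE \<delta> w a0 s0 / w) \<longlongrightarrow> 1 / (inverse (1 + 4 / pi\<^sup>2) - 1 / \<delta>)) (at_right 0)"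
proof -
  define z where "z = (a0, sqrt s0)"
  have z: "0 < fst z" "0 \<le> snd z" using a0 s0 by (auto simp: z_def)
  obtain N where N: "eventually (\<lambda>w. (se_step \<delta> w ^^ N) z \<in> contraction_box) (at_right 0)"
    using orbit_enters_box[OF \<delta> z] by blast
  define fixp where "fixp w p \<longleftrightarrow> p \<in> contraction_box \<and> se_step \<delta> w p = p \<and>
    mse_seq \<delta> w a0 s0 \<longlonglongrightarrow> (1 - fst p)\<^sup>2 + (snd p)\<^sup>2" for w p
  have "eventually (\<lambda>w::real. w < 1 / 100000000) (at_right 0)"
    by (rule eventually_at_rightI[of 0 "1 / 100000000"]) auto
  then have "eventually (\<lambda>w. \<exists>p. fixp w p) (at_right 0)"
    using N eventually_at_right_less[of 0]
  proof eventually_elim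
    case (elim w)
    obtain a s where lim: "(\<lambda>n. (se_step \<delta> w ^^ n) ((se_step \<delta> w ^^ N) z)) \<longlonglongrightarrow> (a, s)"
      and as: "(a, s) \<in> contraction_box" "se_step \<delta> w (a, s) = (a, s)"
      using box_orbit_converges[OF \<delta>, of "(se_step \<delta> w ^^ N) z" w] elim by (metis less_imp_le)
    define y where "y n = (se_step \<delta> w ^^ n) z" for n
    have "(\<lambda>n. y (n + N)) \<longlonglongrightarrow> (a, s)"
      using lim by (simp add: y_def funpow_add)
    then have "y \<longlonglongrightarrow> (a, s)" by (rule LIMSEQ_offset)
    then have ylim: "(\<lambda>n. fst (y n)) \<longlonglongrightarrow> a" "(\<lambda>n. snd (y n)) \<longlonglongrightarrow> s"
      using tendsto_fst[of y "(a, s)"] tendsto_snd[of y "(a, s)"] by auto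
    have "mse_seq \<delta> w a0 s0 = (\<lambda>n. (1 - fst (y n))\<^sup>2 + (snd (y n))\<^sup>2)"
      using SE_eq_orbit[OF delta_pos[OF \<delta>] _ a0 s0, of w] elim(3)
      by (intro ext) (simp add: mse_seq_def y_def z_def abs_of_pos)
    moreover have "(\<lambda>n. (1 - fst (y n))\<^sup>2 + (snd (y n))\<^sup>2) \<longlonglongrightarrow> (1 - a)\<^sup>2 + s\<^sup>2"
      by (intro tendsto_intros ylim)
    ultimately show ?case using as by (intro exI[of _ "(a, s)"]) (simp add: fixp_def)
  qed
  \<comment> \<open>Choosing one limit point for each noise level gives the functions
    \<open>A\<close> and \<open>S\<close> to which \<open>fixed_point_asymptotics\<close>
    applies.\<close>
  then have ev: "eventually (\<lambda>w. fixp w (SOME p. fixp w p)) (at_right 0)"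
    by eventually_elim (rule someI_ex)
  then show "eventually (\<lambda>w. convergent (mse_seq \<delta> w a0 s0)) (at_right 0)"
    by eventually_elim (auto simp: fixp_def convergent_def)
  define A where "A w = fst (SOME p. fixp w p)" for w
  define S where "S w = snd (SOME p. fixp w p)" for w
  have "((\<lambda>w. ((1 - A w)\<^sup>2 + (S w)\<^sup>2) / w) \<longlongrightarrow> 1 / (inverse (1 + 4 / pi\<^sup>2) - 1 / \<delta>)) (at_right 0)"
    by (rule fixed_point_asymptotics[OF \<delta>], rule eventually_mono[OF ev])
       (auto simp: fixp_def A_def S_def)
  moreover have "eventually (\<lambda>w. ((1 - A w)\<^sup>2 + (S w)\<^sup>2) / w = AMSE \<delta> w a0 s0 / w) (at_right 0)"
    using ev by eventually_elim (auto simp: fixp_def A_def S_def AMSE_def limI)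
  ultimately show "((\<lambda>w. AMSE \<delta> w a0 s0 / w) \<longlongrightarrow> 1 / (inverse (1 + 4 / pi\<^sup>2) - 1 / \<delta>)) (at_right 0)"
    by (rule Lim_transform_eventually)
qed

theorem mainTheorem6:
  fixes \<delta> a0 s0 :: real
  assumes "\<delta> > pi^2 / 4 - 1" and "a0 \<noteq> 0" and "s0 \<ge> 0"
  shows "(\<exists>\<epsilon>>0. \<forall>sw2. 0 < sw2 \<and> sw2 < \<epsilon> \<longrightarrow> convergent (mse_seq \<delta> sw2 a0 s0))
       \<and> ((\<lambda>sw2. AMSE \<delta> sw2 a0 s0 / sw2) \<longlongrightarrow> 1 / (inverse (1 + 4 / pi^2) - 1 / \<delta>)) (at_right 0)"
proof -
  have "mse_seq \<delta> w \<bar>a0\<bar> s0 = mse_seq \<delta> w a0 s0" for w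
    using mse_seq_uminus by (auto simp: abs_if)
  then show ?thesis
    using mse_seq_limit_asymptotics[OF assms(1), of "\<bar>a0\<bar>" s0] assms(2,3)
    by (auto simp: eventually_at_right_field AMSE_def)
qed

end
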